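(* For every pair $(b,k)$ in the set $\{(6,6),(7,6),(8,6),(9,6),(10,6),(11,6),(12,6),(13,6),(14,6),(8,7),(9,7),(10,7),(11,7),(12,7),(13,7),(14,7),(10,8),(11,8),(12,8),(13,8),(14,8),(11,9),(12,9),(13,9),(14,9),(13,10),(14,10),(14,11)\}$ one has the strict inequality $$R_{(b,k)}<\left(\frac{1}{\log\frac{b}{k-3}}+\frac{b^{k-1}}{b^{\underline{k-1}}\log(b-k+2)}\right)^{-1},$$ where $b^{\underline{k-1}}=b(b-1)\cdots(b-k+2)$.
   Context: All logarithms are to base 2. For integers $b\ge k$ and $n\ge1$, a $(b,k)$-hash code of length $n$ is a subset $C\subseteq\{1,\dots,b\}^n$ such that for any $k$ distinct elements of $C$ there is a coordinate in which they are pairwise distinct; $A(b,k,n)$ is the largest size of such a code and $R_{(b,k)}=\limsup_{n\to\infty}\frac1n\log A(b,k,n)$. *)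

theory Defs
  imports "HOL-Analysis.Analysis"
begin

definition words :: "nat \<Rightarrow> nat \<Rightarrow> nat list set" where
  "words b n = {w. length w = n \<and> set w \<subseteq> {1..b}}"

definition is_hash_code :: "nat \<Rightarrow> nat \<Rightarrow> nat \<Rightarrow> nat list set \<Rightarrow> bool" where
  "is_hash_code b k n C \<longleftrightarrow> C \<subseteq> words b n \<and>
     (\<forall>S. S \<subseteq> C \<longrightarrow> card S = k \<longrightarrow>
        (\<exists>i<n. inj_on (\<lambda>w. w ! i) S))"

definition A_hash :: "nat \<Rightarrow> nat \<Rightarrow> nat \<Rightarrow> nat" where
  "A_hash b k n = Max (card ` {C. is_hash_code b k n C})"

definition R_hash :: "nat \<Rightarrow> nat \<Rightarrow> ereal" where
  "R_hash b k = limsup (\<lambda>n. ereal (log 2 (real (A_hash b k n)) / real n))"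

end

theory Submission
  imports Defs "HOL-Computational_Algebra.Polynomial"
begin

text \<open>
  Put \<open>m = k - 2\<close>. Fixing \<open>m\<close> codewords, Hansel's inequality bounds \<open>log |C|\<close> by \<open>log (b - m)\<close> times the sum
  over the coordinates of the fraction of codewords whose symbol avoids those of the \<open>m\<close> chosen ones,
  counting only coordinates in which these are pairwise distinct. The \<open>m\<close> words are drawn
  independently from a random cell of the code: the words whose first \<open>l\<close> symbols lie in a random product
  of \<open>m\<close>-element sets. Non-degenerate cells exist as long as \<open>(b/m)\<^sup>l\<close> is a bit smaller than \<open>|C|\<close>. A prefix
  coordinate then contributes only a small fraction of the value \<open>F\<close> of the uniform distribution, and
  taking sets of size \<open>m\<close> instead of \<open>k - 3\<close> is what makes the final inequality strict.

  A later coordinate contributes the average over the cells of \<open>\<psi>(p; q)\<close>, the probability that \<open>m\<close>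
  independent symbols with law \<open>p\<close> (the law in the cell) and one symbol with law \<open>q\<close> (the law in the code) are all
  distinct, where \<open>q\<close> is the average of the \<open>p\<close>. It is at most \<open>F\<close> because
  \<open>\<psi>(p; q) / F \<le> 1 + t b / (b - 1) (|q|\<^sup>2 - p \<bullet> q)\<close> for a suitable constant \<open>t\<close>, and the right-hand side is affine
  in \<open>p\<close>. For the latter, the polynomial \<open>\<Sum>\<^sub>c q\<^sub>c \<Prod>\<^sub>i\<^sub>\<noteq>\<^sub>c (1 + p\<^sub>i z)\<close> is real-rooted, so its normalized
  coefficients satisfy Maclaurin's inequalities; this bounds \<open>\<psi>\<close> by a power of its analogue \<open>X\<close> for \<open>m = 2\<close>.
  Replacing the power of \<open>X\<close> by a chord leaves a sum over the symbols of quadratic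
  forms in \<open>(p\<^sub>a - 1/b, q\<^sub>a - 1/b)\<close>, each of which is nonnegative.
\<close>

section \<open>Newton's inequalities\<close>

text \<open>For \<open>k > N\<close> the binomial coefficient is 0 and division by zero makes the
  value 0; the induction for Newton's inequality relies on this at its upper end.\<close>

definition normalized_coeff :: "nat \<Rightarrow> real poly \<Rightarrow> nat \<Rightarrow> real" where
  "normalized_coeff N P k = coeff P k / real (N choose k)"

lemma coeff_linear_mult:
  "coeff ([:1, x:] * P) k = coeff P k + (if k = 0 then 0 else x * coeff P (k - 1))"
  for x :: "'a :: comm_ring_1"
  by (cases k) (auto simp: coeff_pCons algebra_simps)

text \<open>Normalizing by binomial coefficients turns the recursion for a new linear factor into
  one with weights \<open>N + 1 - k\<close> and \<open>k\<close>. At \<open>k = 0\<close> the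
  truncated index \<open>k - 1\<close> is harmless, since its weight vanishes.\<close>

lemma normalized_coeff_linear_mult:
  assumes "k \<le> N + 1" and deg: "degree P \<le> N"
  shows "(real N + 1) * normalized_coeff (Suc N) ([:1, x:] * P) k
       = (real N + 1 - real k) * normalized_coeff N P k + real k * x * normalized_coeff N P (k - 1)"
proof (cases k)
  case 0
  then show ?thesis by (simp add: normalized_coeff_def)
next
  case (Suc j)
  have j: "j \<le> N" using assms Suc by simp
  have c0: "real (N choose j) > 0" using j by simp
  have c1: "real (Suc N choose Suc j) = (real N + 1) / (real j + 1) * real (N choose j)"
    using Suc_times_binomial_eq[of N j]
    by (simp add: field_simps flip: of_nat_Suc of_nat_mult)
  show ?thesis
  proof (cases "j = N")
    case True
    have "coeff P (Suc N) = 0" using deg by (intro coeff_eq_0) simp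
    then show ?thesis using Suc True
      by (simp add: normalized_coeff_def coeff_linear_mult)
  next
    case False
    hence jN: "j < N" using j by simp
    have "Suc j * (N choose Suc j) = (N - j) * (N choose j)"
      using binomial_absorb_comp binomial_absorption by presburger
    hence c2: "(real j + 1) * real (N choose Suc j) = (real N - real j) * real (N choose j)"
      by (metis of_nat_Suc of_nat_diff of_nat_mult j add.commute)
    have c2p: "real (N choose Suc j) > 0" using jN by simp
    have A: "(real N + 1) / real (Suc N choose Suc j) = (real j + 1) / real (N choose j)"
    proof -
      have "n / (n / j' * c) = j' / c" if "n > 0" "j' > 0" "c > 0" for n j' c :: real
        using that by (simp add: field_simps)
      thus ?thesis unfolding c1 using c0 by simp
    qed
    have B: "(real N - real j) / real (N choose Suc j) = (real j + 1) / real (N choose j)"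
      using c2 c0 c2p by (simp add: field_simps)
    have "(real N + 1) * normalized_coeff (Suc N) ([:1, x:] * P) k
        = ((real N + 1) / real (Suc N choose Suc j)) * (coeff P (Suc j) + x * coeff P j)"
      unfolding Suc normalized_coeff_def coeff_linear_mult by simp
    also have "\<dots> = (real N - real j) / real (N choose Suc j) * coeff P (Suc j)
          + (real j + 1) / real (N choose j) * (x * coeff P j)"
      unfolding A B by (simp add: algebra_simps)
    finally show ?thesis unfolding Suc normalized_coeff_def by (simp add: algebra_simps)
  qed
qed

text \<open>Here \<open>a\<close>, \<open>b\<close>, \<open>c\<close>, \<open>d\<close> stand for
  consecutive normalized coefficients before the factor \<open>1 + x z\<close> is multiplied in, and
  \<open>u\<close> for \<open>N + 1 - k\<close>. The difference of the two sides is a sum of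
  nonnegative multiples of \<open>c^2 - b d\<close>, \<open>b^2 - a c\<close>,
  \<open>b c - a d\<close> and the square of \<open>c - x b\<close>. For the third, multiply the two
  last hypotheses and cancel \<open>b c\<close>.\<close>

lemma newton_step_aux:
  fixes a b c d u k x :: real
  assumes nn: "a \<ge> 0" "b > 0" "c > 0" "d \<ge> 0" "x \<ge> 0" and u: "u \<ge> 1" and k: "k \<ge> 1"
    and bd: "b * d \<le> c\<^sup>2" and ac: "a * c \<le> b\<^sup>2"
  shows "((u + 1) * b + (k - 1) * x * a) * ((u - 1) * d + (k + 1) * x * c) \<le> (u * c + k * x * b)\<^sup>2"
proof -
  have "(a * d) * (b * c) \<le> (b * c) * (b * c)"
    using mult_mono[OF bd ac] nn by (simp add: power2_eq_square algebra_simps)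
  hence ad: "a * d \<le> b * c" using nn by (simp add: mult_le_cancel_right)
  have "(u * c + k * x * b)\<^sup>2 - ((u + 1) * b + (k - 1) * x * a) * ((u - 1) * d + (k + 1) * x * c)
     = (u\<^sup>2 - 1) * (c\<^sup>2 - b * d) + x\<^sup>2 * ((k\<^sup>2 - 1) * (b\<^sup>2 - a * c))
       + x * ((k - 1) * (u - 1)) * (b * c - a * d) + (c - x * b)\<^sup>2"
    by (simp add: power2_eq_square algebra_simps)
  also have "\<dots> \<ge> 0"
    using nn u k bd ac ad by (intro add_nonneg_nonneg mult_nonneg_nonneg) (auto simp: one_le_power)
  finally show ?thesis by simp
qed

text \<open>Induction on the number of linear factors. Positivity is carried along because the step
  cancels coefficients.\<close>

lemma newton_inequality:
  assumes "finite I" "\<And>i. i \<in> I \<Longrightarrow> \<rho> i > (0::real)"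
  shows "(\<forall>k\<le>card I. normalized_coeff (card I) (\<Prod>i\<in>I. [:1, \<rho> i:]) k > 0) \<and>
         (\<forall>k. 1 \<le> k \<longrightarrow> k < card I \<longrightarrow>
            normalized_coeff (card I) (\<Prod>i\<in>I. [:1, \<rho> i:]) (k - 1) *
            normalized_coeff (card I) (\<Prod>i\<in>I. [:1, \<rho> i:]) (k + 1)
              \<le> (normalized_coeff (card I) (\<Prod>i\<in>I. [:1, \<rho> i:]) k)\<^sup>2)"
  using assms
proof (induction I rule: finite_induct)
  case empty
  then show ?case by (simp add: normalized_coeff_def)
next
  case (insert i I)
  define N where "N = card I"
  define P where "P = (\<Prod>i\<in>I. [:1, \<rho> i:])"
  define E where "E = normalized_coeff N P"
  define E' where "E' = normalized_coeff (Suc N) ([:1, \<rho> i:] * P)"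
  have x: "\<rho> i > 0" using insert by simp
  have deg: "degree P \<le> N"
  proof -
    have "degree P \<le> (\<Sum>i\<in>I. degree [:1, \<rho> i:])"
      unfolding P_def using degree_prod_sum_le[OF insert.hyps(1), of "\<lambda>i. [:1, \<rho> i:]"] by (simp only: o_def)
    also have "\<dots> \<le> (\<Sum>i\<in>I. 1)" by (intro sum_mono) auto
    finally show ?thesis by (simp add: N_def)
  qed
  have pos: "E k > 0" if "k \<le> N" for k using insert that by (simp add: E_def P_def N_def)
  have newt: "E (k - 1) * E (k + 1) \<le> (E k)\<^sup>2" if "1 \<le> k" "k < N" for k
    using insert that by (simp add: E_def P_def N_def)
  have top: "E k = 0" if "k > N" for k
    using that by (simp add: E_def normalized_coeff_def)
  have rec: "(real N + 1) * E' k = (real N + 1 - real k) * E k + real k * \<rho> i * E (k - 1)"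
    if "k \<le> N + 1" for k
    using normalized_coeff_linear_mult[OF that deg] by (simp add: E_def E'_def)
  have pos': "E' k > 0" if "k \<le> Suc N" for k
  proof -
    have "(real N + 1 - real k) * E k + real k * \<rho> i * E (k - 1) > 0"
    proof (cases "k = 0")
      case True then show ?thesis using pos[of 0] by simp
    next
      case False
      have "E (k - 1) > 0" using pos that False by simp
      moreover have "(real N + 1 - real k) * E k \<ge> 0"
        using that pos[of k] top[of k] by (cases "k \<le> N") auto
      ultimately show ?thesis using x False by (intro add_nonneg_pos) auto
    qed
    hence "(real N + 1) * E' k > 0" using rec that by simp
    thus ?thesis by (simp add: zero_less_mult_iff)
  qed
  have newt': "E' (k - 1) * E' (k + 1) \<le> (E' k)\<^sup>2" if k: "1 \<le> k" "k < Suc N" for k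
  proof -
    \<comment> \<open>The coefficient of index -1 must be 0, but for \<open>k = 1\<close> truncated
      subtraction would read \<open>E (k - 2)\<close> as \<open>E 0\<close>.\<close>
    define a where "a = (if k = 1 then 0 else E (k - 2))"
    have r1: "(real N + 1) * E' (k - 1) = (real N + 1 - real k + 1) * E (k - 1) + (real k - 1) * \<rho> i * a"
      using rec[of "k - 1"] k by (auto simp: a_def of_nat_diff numeral_2_eq_2)
    have r2: "(real N + 1) * E' (k + 1) = (real N + 1 - real k - 1) * E (k + 1) + (real k + 1) * \<rho> i * E k"
      using rec[of "k + 1"] k by (simp add: algebra_simps)
    have r3: "(real N + 1) * E' k = (real N + 1 - real k) * E k + real k * \<rho> i * E (k - 1)"
      using rec[of k] k by simp
    have "((real N + 1) * E' (k - 1)) * ((real N + 1) * E' (k + 1)) \<le> ((real N + 1) * E' k)\<^sup>2"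
      unfolding r1 r2 r3
    proof (rule newton_step_aux)
      show "0 \<le> a" using pos[of "k-2"] k by (auto simp: a_def intro: less_imp_le)
      show "0 < E (k - 1)" "0 < E k" using pos k by auto
      show "0 \<le> E (k + 1)" using pos[of "k+1"] top[of "k+1"] by (cases "k + 1 \<le> N") auto
      show "E (k - 1) * E (k + 1) \<le> (E k)\<^sup>2"
        using newt[of k] top[of "k+1"] k by (cases "k < N") auto
      show "a * E k \<le> (E (k - 1))\<^sup>2"
        using newt[of "k-1"] k by (auto simp: a_def numeral_2_eq_2 Suc_diff_Suc)
    qed (use x k in auto)
    hence "(real N + 1)\<^sup>2 * (E' (k - 1) * E' (k + 1)) \<le> (real N + 1)\<^sup>2 * (E' k)\<^sup>2"
      by (simp add: power2_eq_square algebra_simps)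
    thus ?thesis by (simp add: mult_le_cancel_left)
  qed
  have c: "card (insert i I) = Suc N" "(\<Prod>i\<in>insert i I. [:1, \<rho> i:]) = [:1, \<rho> i:] * P"
    using insert by (simp_all add: N_def P_def)
  show ?case unfolding c using pos' newt' unfolding E'_def by blast
qed

text \<open>Newton bounds every ratio \<open>a (k + 1) / a k\<close> with \<open>k >= 1\<close> by
  \<open>s = a 2 / a 1\<close>, and also gives \<open>s <= a 1\<close>. So raising \<open>m\<close>
  by one multiplies the square by at most \<open>s^2 <= s * a 1 = a 2\<close>. Squaring avoids the
  fractional power in Maclaurin's inequality.\<close>

lemma maclaurin_from_newton:
  fixes a :: "nat \<Rightarrow> real"
  assumes a0: "a 0 = 1" and pos: "\<And>k. k \<le> N \<Longrightarrow> a k > 0"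
    and newton: "\<And>k. 1 \<le> k \<Longrightarrow> k < N \<Longrightarrow> a (k - 1) * a (k + 1) \<le> (a k)\<^sup>2"
    and m: "2 \<le> m" "m \<le> N"
  shows "(a m)\<^sup>2 \<le> (a 2) ^ m"
proof -
  define s where "s = a 2 / a 1"
  have a1: "a 1 > 0" and a2: "a 2 > 0" using pos m by auto
  have s0: "s > 0" using a1 a2 by (simp add: s_def)
  have sa: "s * a 1 = a 2" using a1 by (simp add: s_def)
  have s1: "s \<le> a 1"
    using newton[of 1] m a0 a1 by (simp add: s_def divide_le_eq power2_eq_square numeral_2_eq_2)
  have step: "a (k + 1) \<le> s * a k" if "1 \<le> k" "k < N" for k
    using that
  proof (induction k rule: nat_induct_at_least)
    case base
    then show ?case using sa by (simp add: numeral_2_eq_2)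
  next
    case (Suc k)
    have "a (Suc k - 1) * a (Suc k + 1) \<le> (a (Suc k))\<^sup>2" using newton[of "Suc k"] Suc by simp
    hence "a k * a (Suc k + 1) \<le> (s * a k) * a (Suc k)"
      using Suc pos[of "Suc k"] by (simp add: power2_eq_square order_trans[OF _ mult_right_mono])
    moreover have "a k > 0" using pos Suc by simp
    ultimately show ?case by (simp add: mult.assoc mult.left_commute[of s])
  qed
  have "(a m)\<^sup>2 \<le> (a 2) ^ m" if "2 \<le> m" "m \<le> N" using that
  proof (induction m rule: nat_induct_at_least)
    case base then show ?case by simp
  next
    case (Suc k)
    have "a (Suc k) \<le> s * a k" using step[of k] Suc by simp
    hence "(a (Suc k))\<^sup>2 \<le> (s * a k)\<^sup>2" using pos[of "Suc k"] Suc by (intro power_mono) auto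
    also have "\<dots> = (s * s) * (a k)\<^sup>2" by (simp add: power2_eq_square)
    also have "\<dots> \<le> (s * a 1) * (a 2) ^ k"
      using Suc s0 s1 a1 by (intro mult_mono) auto
    finally show ?case using sa by simp
  qed
  thus ?thesis using m by simp
qed

section \<open>Real-rootedness of mixed elementary symmetric polynomials\<close>

definition mixed_poly :: "(nat \<Rightarrow> real) \<Rightarrow> (nat \<Rightarrow> real) \<Rightarrow> nat set \<Rightarrow> real poly" where
  "mixed_poly p q U = (\<Sum>c\<in>U. smult (q c) (\<Prod>i\<in>U - {c}. [:1, p i:]))"

text \<open>The factor \<open>1 + p a z\<close> vanishes at this point, and the summand
  \<open>c = a\<close> is the only one without it.\<close>

lemma poly_mixed_poly_at_root:
  assumes U: "finite U" "a \<in> U" and a: "p a \<noteq> 0"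
  shows "poly (mixed_poly p q U) (-1 / p a) = q a * (\<Prod>i\<in>U - {a}. 1 - p i / p a)"
proof -
  have "poly (mixed_poly p q U) (-1 / p a)
      = (\<Sum>c\<in>U. q c * (\<Prod>i\<in>U - {c}. 1 - p i / p a))"
    by (simp add: mixed_poly_def poly_sum poly_prod)
  also have "\<dots> = (\<Sum>c\<in>{a}. q c * (\<Prod>i\<in>U - {c}. 1 - p i / p a))"
  proof (rule sum.mono_neutral_right)
    show "\<forall>c\<in>U - {a}. q c * (\<Prod>i\<in>U - {c}. 1 - p i / p a) = 0"
    proof
      fix c assume "c \<in> U - {a}"
      hence "(\<Prod>i\<in>U - {c}. 1 - p i / p a) = 0"
        using U a by (intro prod_zero) (auto intro!: bexI[of _ a])
      thus "q c * (\<Prod>i\<in>U - {c}. 1 - p i / p a) = 0" by simp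
    qed
  qed (use U in auto)
  finally show ?thesis by simp
qed

text \<open>\<open>p a\<close> and \<open>p c\<close> are neighbours among the values of
  \<open>p\<close>, so for every other \<open>i\<close> the factors \<open>1 - p i / p a\<close> and
  \<open>1 - p i / p c\<close> have the same sign. The remaining pair, with \<open>p c / p a\<close>
  and \<open>p a / p c\<close>, has opposite signs.\<close>

lemma mixed_poly_sign_change:
  assumes U: "finite U" "a \<in> U" "c \<in> U" and pos: "\<And>i. i \<in> U \<Longrightarrow> p i > 0" "\<And>i. i \<in> U \<Longrightarrow> q i > 0"
    and inj: "inj_on p U" and ac: "p a < p c"
    and nxt: "\<And>i. i \<in> U \<Longrightarrow> p a < p i \<Longrightarrow> p c \<le> p i"
  shows "poly (mixed_poly p q U) (-1 / p a) * poly (mixed_poly p q U) (-1 / p c) < 0"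
proof -
  have ne: "a \<noteq> c" using ac by auto
  define W where "W = U - {a, c}"
  have Wa: "U - {a} = insert c W" and Wc: "U - {c} = insert a W" and Wn: "a \<notin> W" "c \<notin> W" and Wf: "finite W"
    using U ne by (auto simp: W_def)
  have pa: "p a > 0" and pc: "p c > 0" using pos U by auto
  have "(\<Prod>i\<in>W. (1 - p i / p a) * (1 - p i / p c)) > 0"
  proof (rule prod_pos)
    fix i assume i: "i \<in> W"
    hence iU: "i \<in> U" "i \<noteq> a" "i \<noteq> c" by (auto simp: W_def)
    hence d: "p i \<noteq> p a" "p i \<noteq> p c" using inj U by (auto dest: inj_onD)
    show "0 < (1 - p i / p a) * (1 - p i / p c)"
    proof (cases "p a < p i")
      case True
      hence "p c < p i" using nxt[OF iU(1)] d by simp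
      thus ?thesis using True pa pc by (intro mult_neg_neg) (auto simp: field_simps)
    next
      case False
      hence "p i < p a" using d by simp
      thus ?thesis using ac pa pc by (intro mult_pos_pos) (auto simp: field_simps)
    qed
  qed
  hence W: "(\<Prod>i\<in>W. 1 - p i / p a) * (\<Prod>i\<in>W. 1 - p i / p c) > 0"
    by (simp add: prod.distrib)
  have "1 - p c / p a < 0" "1 - p a / p c > 0" using ac pa pc by (auto simp: field_simps)
  hence "(1 - p c / p a) * (1 - p a / p c) < 0" by (simp add: mult_neg_pos)
  moreover have "q a * q c > 0" using pos U by simp
  ultimately have "(q a * q c) * ((1 - p c / p a) * (1 - p a / p c)) *
      ((\<Prod>i\<in>W. 1 - p i / p a) * (\<Prod>i\<in>W. 1 - p i / p c)) < 0"
    using W by (metis mult_neg_pos mult_pos_neg)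
  also have "(q a * q c) * ((1 - p c / p a) * (1 - p a / p c)) *
      ((\<Prod>i\<in>W. 1 - p i / p a) * (\<Prod>i\<in>W. 1 - p i / p c))
     = poly (mixed_poly p q U) (-1 / p a) * poly (mixed_poly p q U) (-1 / p c)"
    using poly_mixed_poly_at_root[of U a p q] poly_mixed_poly_at_root[of U c p q] U pa pc Wn Wf
    unfolding Wa Wc by simp
  finally show ?thesis .
qed

lemma degree_mixed_poly:
  assumes "finite U" "card U = Suc N"
  shows "degree (mixed_poly p q U) \<le> N"
  unfolding mixed_poly_def
proof (rule degree_sum_le)
  fix c assume c: "c \<in> U"
  have "degree (\<Prod>i\<in>U - {c}. [:1, p i:]) \<le> (\<Sum>i\<in>U - {c}. degree [:1, p i:])"
    using degree_prod_sum_le[of "U - {c}" "\<lambda>i. [:1, p i:]"] assms by (simp add: o_def)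
  also have "\<dots> \<le> (\<Sum>i\<in>U - {c}. 1)" by (intro sum_mono) auto
  also have "\<dots> = N" using assms c by simp
  finally show "degree (smult (q c) (\<Prod>i\<in>U - {c}. [:1, p i:])) \<le> N"
    using degree_smult_le order_trans by blast
qed (use assms in auto)

text \<open>Between the points \<open>-1 / p a\<close> of two neighbouring values of
  \<open>p\<close> the sign changes, which yields one root for every index except that of the
  largest value. These \<open>N\<close> negative roots exhaust the degree.\<close>

lemma mixed_poly_real_rooted:
  assumes U: "finite U" "card U = Suc N" and inj: "inj_on p U"
    and pos: "\<And>i. i \<in> U \<Longrightarrow> p i > 0" "\<And>i. i \<in> U \<Longrightarrow> q i > 0" and q1: "sum q U = 1"
  obtains V :: "nat set" and \<rho> where "finite V" "card V = N" "\<And>i. i \<in> V \<Longrightarrow> \<rho> i > 0"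
    "mixed_poly p q U = (\<Prod>i\<in>V. [:1, \<rho> i:])"
proof -
  define F where "F = mixed_poly p q U"
  have Une: "U \<noteq> {}" using U by auto
  define M where "M = Max (p ` U)"
  have "M \<in> p ` U" unfolding M_def by (rule Max_in) (use U Une in auto)
  then obtain a0 where a0: "a0 \<in> U" "p a0 = M" by (auto elim!: imageE)
  have max: "p i \<le> p a0" if "i \<in> U" for i using that U a0 by (simp add: M_def)
  define V where "V = U - {a0}"
  have V: "finite V" "card V = N" using U a0 by (auto simp: V_def)
  have "\<exists>c\<in>U. p a < p c \<and> (\<forall>i\<in>U. p a < p i \<longrightarrow> p c \<le> p i)" if a: "a \<in> V" for a
  proof -
    define S where "S = {i \<in> U. p a < p i}"
    have "p a < p a0" using a max[of a] inj a0 by (auto simp: V_def dest: inj_onD order.not_eq_order_implies_strict)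
    hence S: "finite S" "S \<noteq> {}" using U a0 by (auto simp: S_def)
    have "Min (p ` S) \<in> p ` S" using S by (intro Min_in) auto
    then obtain c where c: "c \<in> S" "p c = Min (p ` S)" by auto
    have "p c \<le> p i" if "i \<in> S" for i using that c S by simp
    moreover have "c \<in> U" "p a < p c" using c(1) by (auto simp: S_def)
    ultimately show ?thesis by (auto simp: S_def intro!: bexI[of _ c])
  qed
  then obtain nx where nx: "\<And>a. a \<in> V \<Longrightarrow> nx a \<in> U" "\<And>a. a \<in> V \<Longrightarrow> p a < p (nx a)"
     "\<And>a i. a \<in> V \<Longrightarrow> i \<in> U \<Longrightarrow> p a < p i \<Longrightarrow> p (nx a) \<le> p i" by metis
  have "\<exists>x. -1 / p a < x \<and> x < -1 / p (nx a) \<and> poly F x = 0" if a: "a \<in> V" for a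
  proof -
    have aU: "a \<in> U" using a by (simp add: V_def)
    have "-1 / p a < -1 / p (nx a)"
      using nx[OF a] pos aU by (simp add: field_simps)
    moreover have "poly F (-1 / p a) * poly F (-1 / p (nx a)) < 0"
      unfolding F_def using a aU nx U pos inj by (intro mixed_poly_sign_change) auto
    ultimately show ?thesis using poly_IVT[of "-1 / p a" "-1 / p (nx a)" F] by auto
  qed
  then obtain rt where rt: "\<And>a. a \<in> V \<Longrightarrow> -1 / p a < rt a" "\<And>a. a \<in> V \<Longrightarrow> rt a < -1 / p (nx a)"
     "\<And>a. a \<in> V \<Longrightarrow> poly F (rt a) = 0" by metis
  have rt_neg: "rt a < 0" if "a \<in> V" for a
  proof -
    have "p (nx a) > 0" using nx pos that by blast
    hence "-1 / p (nx a) < 0" by simp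
    thus ?thesis using rt(2)[OF that] by linarith
  qed
  \<comment> \<open>The open intervals that contain the roots do not overlap, so the roots are
    ordered like the values of \<open>p\<close> and are distinct.\<close>
  have mono: "rt a < rt c" if "a \<in> V" "c \<in> V" "p a < p c" for a c
  proof -
    have "p (nx a) \<le> p c" using nx(3)[of a c] that by (auto simp: V_def)
    moreover have "p (nx a) > 0" "p c > 0" using nx pos that by (auto simp: V_def)
    ultimately have "-1 / p (nx a) \<le> -1 / p c" by (simp add: field_simps)
    thus ?thesis using rt(2)[OF that(1)] rt(1)[OF that(2)] by linarith
  qed
  have injrt: "inj_on rt V"
  proof (rule inj_onI)
    fix a c assume ac: "a \<in> V" "c \<in> V" "rt a = rt c"
    have "p a = p c" using mono[of a c] mono[of c a] ac by (cases "p a" "p c" rule: linorder_cases) auto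
    thus "a = c" using ac inj by (auto simp: V_def dest: inj_onD)
  qed
  define \<rho> where "\<rho> a = -1 / rt a" for a
  define G where "G = (\<Prod>i\<in>V. [:1, \<rho> i:])"
  \<comment> \<open>Both polynomials have degree at most \<open>N\<close>, so agreement at the
    \<open>N\<close> roots and at 0, where both equal 1, suffices. No leading coefficient has to be
    computed.\<close>
  define A where "A = insert 0 (rt ` V)"
  have "0 \<notin> rt ` V" using rt_neg by force
  hence cardA: "card A = Suc N"
    using V injrt unfolding A_def
    by (subst card_insert_disjoint) (auto simp: card_image)
  have degG: "degree G \<le> N"
  proof -
    have "degree G \<le> (\<Sum>i\<in>V. degree [:1, \<rho> i:])"
      using degree_prod_sum_le[of V "\<lambda>i. [:1, \<rho> i:]"] V by (simp add: o_def G_def)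
    also have "\<dots> \<le> (\<Sum>i\<in>V. 1)" by (intro sum_mono) auto
    finally show ?thesis using V by simp
  qed
  have "F = G"
  proof (rule poly_eqI_degree[of A])
    fix x assume "x \<in> A"
    then consider "x = 0" | a where "a \<in> V" "x = rt a" by (auto simp: A_def)
    thus "poly F x = poly G x"
    proof cases
      case 1
      have "poly F 0 = 1" using q1 by (simp add: F_def mixed_poly_def poly_sum poly_prod)
      thus ?thesis using 1 by (simp add: G_def poly_prod)
    next
      case 2
      have "poly G x = 0" unfolding G_def poly_prod
        using V 2 rt_neg[of a] by (intro prod_zero) (auto intro!: bexI[of _ a] simp: \<rho>_def)
      thus ?thesis using rt 2 by simp
    qed
  qed (use cardA degG degree_mixed_poly[OF U, of p q] in \<open>auto simp: F_def\<close>)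
  moreover have "\<rho> i > 0" if "i \<in> V" for i using rt_neg[OF that] by (simp add: \<rho>_def divide_pos_neg zero_less_divide_iff)
  ultimately show ?thesis using that[of V \<rho>] V by (simp add: F_def G_def)
qed

text \<open>The generic case: strictly positive \<open>p\<close> and \<open>q\<close> and distinct
  values of \<open>p\<close>, as real-rootedness requires. \<open>mixed_maclaurin\<close> removes
  these restrictions.\<close>

lemma mixed_maclaurin_generic:
  assumes U: "finite U" "card U = Suc N" and inj: "inj_on p U"
    and pos: "\<And>i. i \<in> U \<Longrightarrow> p i > 0" "\<And>i. i \<in> U \<Longrightarrow> q i > 0" and q1: "sum q U = 1"
    and m: "2 \<le> m" "m \<le> N"
  shows "(normalized_coeff N (mixed_poly p q U) m)\<^sup>2 \<le> normalized_coeff N (mixed_poly p q U) 2 ^ m"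
    and "normalized_coeff N (mixed_poly p q U) 2 \<le> (normalized_coeff N (mixed_poly p q U) 1)\<^sup>2"
    and "normalized_coeff N (mixed_poly p q U) 2 \<ge> 0"
proof -
  obtain V :: "nat set" and \<rho> where V: "finite V" "card V = N" "\<And>i. i \<in> V \<Longrightarrow> \<rho> i > 0"
    and F: "mixed_poly p q U = (\<Prod>i\<in>V. [:1, \<rho> i:])"
    using mixed_poly_real_rooted[OF U inj pos q1] by metis
  define a where "a = normalized_coeff N (mixed_poly p q U)"
  have newt: "(\<forall>k\<le>N. a k > 0) \<and> (\<forall>k. 1 \<le> k \<longrightarrow> k < N \<longrightarrow> a (k - 1) * a (k + 1) \<le> (a k)\<^sup>2)"
    using newton_inequality[OF V(1), of \<rho>] V unfolding a_def F by auto
  have "coeff (mixed_poly p q U) 0 = 1"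
    unfolding poly_0_coeff_0[symmetric] using q1 by (simp add: mixed_poly_def poly_sum poly_prod)
  hence a0: "a 0 = 1" by (simp add: a_def normalized_coeff_def)
  show "(a m)\<^sup>2 \<le> a 2 ^ m" using newt a0 m by (intro maclaurin_from_newton[of a N]) auto
  have "a (1 - 1) * a (1 + 1) \<le> (a 1)\<^sup>2" using newt m by auto
  thus "a 2 \<le> (a 1)\<^sup>2" using a0 by (simp add: numeral_2_eq_2)
  show "a 2 \<ge> 0" using newt m by (auto intro: less_imp_le)
qed

lemma tendsto_coeff_prod_linear:
  fixes f :: "'b \<Rightarrow> 'a \<Rightarrow> real"
  assumes "finite I" "\<And>i. i \<in> I \<Longrightarrow> ((\<lambda>x. f x i) \<longlongrightarrow> g i) L"
  shows "((\<lambda>x. coeff (\<Prod>i\<in>I. [:1, f x i:]) k) \<longlongrightarrow> coeff (\<Prod>i\<in>I. [:1, g i:]) k) L"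
  using assms
proof (induction I arbitrary: k rule: finite_induct)
  case (insert i I)
  then show ?case unfolding prod.insert[OF insert.hyps] coeff_linear_mult
    by (cases "k = 0") (auto intro!: tendsto_intros)
qed simp

text \<open>The inequalities are closed conditions, so they pass to the limit of generic data.
  Adding \<open>\<epsilon> * (i + 1)\<close> to \<open>p i\<close> breaks ties, while unequal values
  stay unequal for small \<open>\<epsilon>\<close>; \<open>q\<close> is shifted and rescaled so that
  its sum stays 1.\<close>

lemma mixed_maclaurin:
  assumes U: "finite U" "card U = Suc N"
    and nn: "\<And>i. i \<in> U \<Longrightarrow> p i \<ge> 0" "\<And>i. i \<in> U \<Longrightarrow> q i \<ge> 0" and q1: "sum q U = 1"
    and m: "2 \<le> m" "m \<le> N"
  shows "(normalized_coeff N (mixed_poly p q U) m)\<^sup>2 \<le> normalized_coeff N (mixed_poly p q U) 2 ^ m"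
    and "normalized_coeff N (mixed_poly p q U) 2 \<le> (normalized_coeff N (mixed_poly p q U) 1)\<^sup>2"
    and "normalized_coeff N (mixed_poly p q U) 2 \<ge> 0"
proof -
  define pe where "pe \<epsilon> i = p i + \<epsilon> * (real i + 1)" for \<epsilon> i
  define qe where "qe \<epsilon> i = (q i + \<epsilon>) / (1 + \<epsilon> * real (Suc N))" for \<epsilon> i
  define a where "a \<epsilon> k = normalized_coeff N (mixed_poly (pe \<epsilon>) (qe \<epsilon>) U) k" for \<epsilon> k
  let ?L = "at_right (0::real)"
  have e0: "((\<lambda>\<epsilon>. \<epsilon>) \<longlongrightarrow> (0::real)) ?L" by (rule tendsto_ident_at)
  have lim: "((\<lambda>\<epsilon>. a \<epsilon> k) \<longlongrightarrow> normalized_coeff N (mixed_poly p q U) k) ?L" for k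
  proof -
    have pl: "((\<lambda>\<epsilon>. pe \<epsilon> i) \<longlongrightarrow> p i) ?L" for i
      unfolding pe_def by (rule tendsto_eq_intros e0 refl | simp)+
    have ql: "((\<lambda>\<epsilon>. qe \<epsilon> i) \<longlongrightarrow> q i) ?L" for i
      unfolding qe_def by (rule tendsto_eq_intros e0 refl | simp)+
    show ?thesis unfolding a_def normalized_coeff_def mixed_poly_def coeff_sum coeff_smult divide_inverse
      by (intro tendsto_intros ql tendsto_coeff_prod_linear pl) (use U in auto)
  qed
  have inj: "eventually (\<lambda>\<epsilon>. inj_on (pe \<epsilon>) U) ?L"
  proof -
    have "eventually (\<lambda>\<epsilon>. pe \<epsilon> i \<noteq> pe \<epsilon> j) ?L" if "i \<noteq> j" for i j
    proof (cases "p i = p j")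
      case True
      show ?thesis using eventually_at_right_less[of "0::real"]
        by eventually_elim (use True that in \<open>auto simp: pe_def\<close>)
    next
      case False
      have "((\<lambda>\<epsilon>. pe \<epsilon> i - pe \<epsilon> j) \<longlongrightarrow> p i - p j) ?L"
        unfolding pe_def by (rule tendsto_eq_intros e0 refl | simp)+
      hence "eventually (\<lambda>\<epsilon>. pe \<epsilon> i - pe \<epsilon> j \<noteq> 0) ?L"
        using False by (intro tendsto_imp_eventually_ne) auto
      thus ?thesis by eventually_elim auto
    qed
    hence "eventually (\<lambda>\<epsilon>. \<forall>i\<in>U. \<forall>j\<in>U. i \<noteq> j \<longrightarrow> pe \<epsilon> i \<noteq> pe \<epsilon> j) ?L"
      using U by (intro eventually_ball_finite ballI) (auto simp: eventually_conj_iff)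
    thus ?thesis by eventually_elim (auto simp: inj_on_def)
  qed
  have ev: "eventually (\<lambda>\<epsilon>. (a \<epsilon> m)\<^sup>2 \<le> a \<epsilon> 2 ^ m \<and> a \<epsilon> 2 \<le> (a \<epsilon> 1)\<^sup>2 \<and> a \<epsilon> 2 \<ge> 0) ?L"
    using inj eventually_at_right_less[of "0::real"]
  proof eventually_elim
    case (elim \<epsilon>)
    have pp: "pe \<epsilon> i > 0" if "i \<in> U" for i
      using nn(1)[OF that] elim by (simp add: pe_def add_nonneg_pos)
    have d: "1 + \<epsilon> * real (Suc N) > 0" using elim by (simp add: add_pos_nonneg)
    have qp: "qe \<epsilon> i > 0" if "i \<in> U" for i
      using nn(2)[OF that] elim d unfolding qe_def by (intro divide_pos_pos) auto
    have "sum (qe \<epsilon>) U = (sum q U + \<epsilon> * real (Suc N)) / (1 + \<epsilon> * real (Suc N))"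
      unfolding qe_def sum_divide_distrib[symmetric] using U by (simp add: sum.distrib)
    hence "sum (qe \<epsilon>) U = 1" using q1 d by simp
    note * = mixed_maclaurin_generic[of U N "pe \<epsilon>" "qe \<epsilon>", OF U elim(1) pp qp this m]
    show ?case unfolding a_def by (intro conjI *)
  qed
  have nt: "?L \<noteq> bot" by simp
  show "(normalized_coeff N (mixed_poly p q U) m)\<^sup>2 \<le> normalized_coeff N (mixed_poly p q U) 2 ^ m"
    by (rule tendsto_le[OF nt tendsto_power[OF lim[of 2]] tendsto_power[OF lim[of m]]])
       (use ev in eventually_elim, auto)
  show "normalized_coeff N (mixed_poly p q U) 2 \<le> (normalized_coeff N (mixed_poly p q U) 1)\<^sup>2"
    by (rule tendsto_le[OF nt tendsto_power[OF lim[of 1]] lim[of 2]])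
       (use ev in eventually_elim, auto)
  show "normalized_coeff N (mixed_poly p q U) 2 \<ge> 0"
    by (rule tendsto_le[OF nt lim[of 2] tendsto_const])
       (use ev in eventually_elim, auto)
qed

section \<open>Symmetric sums over tuples of distinct symbols\<close>

fun inj_sum :: "(nat \<Rightarrow> real) \<Rightarrow> nat \<Rightarrow> nat set \<Rightarrow> real" where
  "inj_sum p 0 U = 1"
| "inj_sum p (Suc m) U = (\<Sum>a\<in>U. p a * inj_sum p m (U - {a}))"

text \<open>\<open>inj_sum p m U\<close> is \<open>m!\<close> times the elementary symmetric
  polynomial of degree \<open>m\<close>, as a sum over ordered tuples of distinct elements. For
  probability vectors \<open>p\<close> and \<open>q\<close>, \<open>mixed_sum\<close> is the
  probability that \<open>m\<close> independent symbols with law \<open>p\<close> and one with law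
  \<open>q\<close> are all distinct.\<close>

definition mixed_sum :: "(nat \<Rightarrow> real) \<Rightarrow> (nat \<Rightarrow> real) \<Rightarrow> nat \<Rightarrow> nat set \<Rightarrow> real" where
  "mixed_sum p q m U = (\<Sum>c\<in>U. q c * inj_sum p m (U - {c}))"

lemma mixed_sum_0: "mixed_sum p q 0 U = sum q U"
  by (simp add: mixed_sum_def)

lemma sum_swap_remove:
  assumes "finite U"
  shows "(\<Sum>c\<in>U. \<Sum>a\<in>U - {c}. f c a) = (\<Sum>a\<in>U. \<Sum>c\<in>U - {a}. (f c a :: real))"
proof -
  have "(\<Sum>c\<in>U. \<Sum>a\<in>U - {c}. f c a) = (\<Sum>c\<in>U. \<Sum>a\<in>{a\<in>U. a \<noteq> c}. f c a)"
    by (intro sum.cong) auto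
  also have "\<dots> = (\<Sum>a\<in>U. \<Sum>c\<in>{c\<in>U. a \<noteq> c}. f c a)"
    using assms by (intro sum.swap_restrict) auto
  also have "\<dots> = (\<Sum>a\<in>U. \<Sum>c\<in>U - {a}. f c a)"
    by (intro sum.cong) auto
  finally show ?thesis .
qed

text \<open>The definition splits off the symbol with law \<open>q\<close> first; here one with law
  \<open>p\<close> comes first. This is the recursion that matches adding a head to a list of
  codewords in \<open>sum_lists_avoid\<close>.\<close>

lemma mixed_sum_Suc:
  assumes "finite U"
  shows "mixed_sum p q (Suc m) U = (\<Sum>a\<in>U. p a * mixed_sum p q m (U - {a}))"
proof -
  have "mixed_sum p q (Suc m) U = (\<Sum>c\<in>U. \<Sum>a\<in>U - {c}. q c * (p a * inj_sum p m (U - {c} - {a})))"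
    by (simp add: mixed_sum_def sum_distrib_left)
  also have "\<dots> = (\<Sum>a\<in>U. \<Sum>c\<in>U - {a}. q c * (p a * inj_sum p m (U - {c} - {a})))"
    by (rule sum_swap_remove[OF assms])
  also have "\<dots> = (\<Sum>a\<in>U. p a * mixed_sum p q m (U - {a}))"
    unfolding mixed_sum_def sum_distrib_left
    by (intro sum.cong refl) (simp_all add: Diff_insert2 mult_ac Diff_insert insert_commute flip: Diff_insert2 Diff_insert)
  finally show ?thesis .
qed

text \<open>Differentiating the product deletes one factor at a time, which is the recursion of
  \<open>inj_sum\<close>; the derivative supplies the factor \<open>m + 1\<close> of the
  factorial.\<close>

lemma inj_sum_eq_coeff:
  assumes "finite U"
  shows "inj_sum p m U = fact m * coeff (\<Prod>i\<in>U. [:1, p i:]) m"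
  using assms
proof (induction m arbitrary: U)
  case 0
  then show ?case by (simp flip: poly_0_coeff_0 add: poly_prod)
next
  case (Suc m)
  have "pderiv (\<Prod>i\<in>U. [:1, p i:]) = (\<Sum>a\<in>U. (\<Prod>i\<in>U - {a}. [:1, p i:]) * pderiv [:1, p a:])"
    by (rule pderiv_prod)
  hence "coeff (pderiv (\<Prod>i\<in>U. [:1, p i:])) m
      = (\<Sum>a\<in>U. coeff ((\<Prod>i\<in>U - {a}. [:1, p i:]) * [:p a:]) m)"
    by (simp add: coeff_sum pderiv_pCons)
  also have "\<dots> = (\<Sum>a\<in>U. p a * coeff (\<Prod>i\<in>U - {a}. [:1, p i:]) m)"
    by simp
  finally have "real (Suc m) * coeff (\<Prod>i\<in>U. [:1, p i:]) (Suc m)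
      = (\<Sum>a\<in>U. p a * coeff (\<Prod>i\<in>U - {a}. [:1, p i:]) m)"
    by (simp add: coeff_pderiv)
  hence "fact (Suc m) * coeff (\<Prod>i\<in>U. [:1, p i:]) (Suc m)
      = fact m * (\<Sum>a\<in>U. p a * coeff (\<Prod>i\<in>U - {a}. [:1, p i:]) m)"
    by (simp add: mult_ac)
  also have "\<dots> = (\<Sum>a\<in>U. p a * inj_sum p m (U - {a}))"
    using Suc by (simp add: sum_distrib_left mult_ac)
  finally show ?case by simp
qed

lemma mixed_sum_eq_coeff:
  assumes "finite U"
  shows "mixed_sum p q m U = fact m * coeff (mixed_poly p q U) m"
  using assms by (simp add: mixed_sum_def mixed_poly_def coeff_sum inj_sum_eq_coeff sum_distrib_left mult_ac)

lemma mixed_sum_maclaurin: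
  fixes p q :: "nat \<Rightarrow> real"
  assumes U: "finite U" "card U = Suc N"
    and nn: "\<And>i. i \<in> U \<Longrightarrow> p i \<ge> 0" "\<And>i. i \<in> U \<Longrightarrow> q i \<ge> 0" and q1: "sum q U = 1"
    and m: "2 \<le> m" "m \<le> N"
  defines "\<mu> \<equiv> \<lambda>k. mixed_sum p q k U / (fact k * real (N choose k))"
  shows "(\<mu> m)\<^sup>2 \<le> \<mu> 2 ^ m" "\<mu> 2 \<le> (\<mu> 1)\<^sup>2" "\<mu> 2 \<ge> 0"
proof -
  have "\<mu> = normalized_coeff N (mixed_poly p q U)"
    using U by (auto simp: \<mu>_def normalized_coeff_def mixed_sum_eq_coeff)
  thus "(\<mu> m)\<^sup>2 \<le> \<mu> 2 ^ m" "\<mu> 2 \<le> (\<mu> 1)\<^sup>2" "\<mu> 2 \<ge> 0"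
    using mixed_maclaurin[OF U nn q1 m] by simp_all
qed

lemma mixed_sum_1:
  assumes "finite U" "sum p U = 1" "sum q U = 1"
  shows "mixed_sum p q 1 U = 1 - (\<Sum>a\<in>U. p a * q a)"
proof -
  have "mixed_sum p q 1 U = (\<Sum>c\<in>U. q c * (\<Sum>a\<in>U - {c}. p a))"
    by (simp add: mixed_sum_def)
  also have "\<dots> = (\<Sum>c\<in>U. q c * (1 - p c))"
    using assms by (intro sum.cong) (auto simp: sum_diff1)
  also have "\<dots> = 1 - (\<Sum>a\<in>U. p a * q a)"
    using assms by (simp add: algebra_simps sum_subtractf)
  finally show ?thesis .
qed

lemma mixed_sum_2:
  assumes U: "finite U" "sum p U = 1" "sum q U = 1"
  shows "mixed_sum p q 2 U = 1 - (\<Sum>a\<in>U. (p a)\<^sup>2) - 2 * (\<Sum>a\<in>U. p a * q a) + 2 * (\<Sum>a\<in>U. q a * (p a)\<^sup>2)"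
proof -
  define s where "s = (\<Sum>a\<in>U. (p a)\<^sup>2)"
  have inner: "(\<Sum>a\<in>U - {c}. p a * (\<Sum>d\<in>U - {c} - {a}. p d)) = 1 - s - 2 * p c + 2 * (p c)\<^sup>2"
    if c: "c \<in> U" for c
  proof -
    have "(\<Sum>a\<in>U - {c}. p a * (\<Sum>d\<in>U - {c} - {a}. p d)) = (\<Sum>a\<in>U - {c}. p a * (1 - p c - p a))"
      using U c by (intro sum.cong) (auto simp: sum_diff1)
    also have "\<dots> = (1 - p c) * (\<Sum>a\<in>U - {c}. p a) - (\<Sum>a\<in>U - {c}. (p a)\<^sup>2)"
      by (simp add: algebra_simps sum_subtractf sum.distrib power2_eq_square sum_distrib_left)
    also have "\<dots> = (1 - p c) * (1 - p c) - (s - (p c)\<^sup>2)"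
      using U c by (simp add: sum_diff1 s_def)
    finally show ?thesis by (simp add: power2_eq_square algebra_simps)
  qed
  have "mixed_sum p q 2 U = (\<Sum>c\<in>U. q c * (\<Sum>a\<in>U - {c}. p a * (\<Sum>d\<in>U - {c} - {a}. p d)))"
    by (simp add: mixed_sum_def numeral_2_eq_2)
  also have "\<dots> = (\<Sum>c\<in>U. q c * (1 - s - 2 * p c + 2 * (p c)\<^sup>2))"
    using inner by (intro sum.cong) auto
  also have "\<dots> = (\<Sum>c\<in>U. (1 - s) * q c - 2 * (p c * q c) + 2 * (q c * (p c)\<^sup>2))"
    by (intro sum.cong) (auto simp: algebra_simps)
  also have "\<dots> = (1 - s) * sum q U - 2 * (\<Sum>a\<in>U. p a * q a) + 2 * (\<Sum>a\<in>U. q a * (p a)\<^sup>2)"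
    by (simp add: sum.distrib sum_subtractf sum_distrib_left)
  finally show ?thesis using U by (simp add: s_def)
qed

section \<open>The key inequality on the simplex\<close>

lemma binary_quadratic_nonneg:
  fixes C t z v y :: real
  assumes "t > 0" "z\<^sup>2 \<le> 4 * t * C"
  shows "C * v\<^sup>2 + z * (v * y) + t * y\<^sup>2 \<ge> 0"
proof -
  have "4 * t * (C * v\<^sup>2 + z * (v * y) + t * y\<^sup>2) = (2 * t * y + z * v)\<^sup>2 + (4 * t * C - z\<^sup>2) * v\<^sup>2"
    by (simp add: power2_eq_square algebra_simps)
  also have "\<dots> \<ge> 0" using assms by simp
  finally show ?thesis using assms by (simp add: zero_le_mult_iff)
qed

lemma square_le_of_bounds:
  fixes z A B D :: real
  assumes "z \<le> A" "- B \<le> z" "A\<^sup>2 \<le> D" "B\<^sup>2 \<le> D"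
  shows "z\<^sup>2 \<le> D"
proof (cases "z \<ge> 0")
  case True
  hence "z\<^sup>2 \<le> A\<^sup>2" using assms by (intro power_mono)
  thus ?thesis using assms by simp
next
  case False
  hence "(- z)\<^sup>2 \<le> B\<^sup>2" using assms by (intro power_mono) auto
  thus ?thesis using assms by simp
qed

text \<open>A discriminant condition that depends affinely on \<open>p\<^sub>a\<close>, at the endpoints \<open>p\<^sub>a = 0\<close> and \<open>p\<^sub>a = 1\<close>.\<close>
definition admissible :: "real \<Rightarrow> real \<Rightarrow> real \<Rightarrow> bool" where
  "admissible b C t \<longleftrightarrow> (2 * C * ((b - 1) / (b - 2)) - t)\<^sup>2 \<le> 4 * t * C \<and>
     (t + 2 * C / (b - 2))\<^sup>2 \<le> 4 * t * C"

text \<open>With \<open>v = p - 1/b\<close> and \<open>y = q - 1/b\<close>, right side minus left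
  side is \<open>b / (b - 1)\<close> times the sum over the symbols of
  \<open>C v^2 + (2 C - t - 2 C g v) v y + t y^2\<close>, where \<open>g = b / (b - 2)\<close>. The
  cubic term is absorbed into the middle coefficient, so each summand is treated as a quadratic form
  in \<open>(v, y)\<close>.\<close>

lemma scaled_mixed_sum_2_le:
  fixes p q :: "nat \<Rightarrow> real" and b C t :: real
  assumes U: "finite U" "b = real (card U)" "b > 2"
    and p: "\<And>i. i \<in> U \<Longrightarrow> p i \<ge> 0" "sum p U = 1" and q1: "sum q U = 1"
    and t: "t > 0" and C: "C \<ge> 0" and adm: "admissible b C t"
  shows "C * (b\<^sup>2 / ((b - 1) * (b - 2)) * mixed_sum p q 2 U - 1)
     \<le> t * (b / (b - 1)) * ((\<Sum>a\<in>U. (q a)\<^sup>2) - (\<Sum>a\<in>U. p a * q a))"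
proof -
  define s where "s = (\<Sum>a\<in>U. (p a)\<^sup>2)"
  define \<pi> where "\<pi> = (\<Sum>a\<in>U. p a * q a)"
  define Q where "Q = (\<Sum>a\<in>U. (q a)\<^sup>2)"
  define M where "M = (\<Sum>a\<in>U. q a * (p a)\<^sup>2)"
  define g where "g = b / (b - 2)"
  define v where "v a = p a - 1 / b" for a
  define y where "y a = q a - 1 / b" for a
  have b0: "b > 0" using U by simp
  have cb: "real (card U) = b" using U(2) by simp
  have p1: "p a \<le> 1" if "a \<in> U" for a
    using member_le_sum[of a U p] p U that by auto
  have "(\<Sum>a\<in>U. C * (v a)\<^sup>2 + (2 * C - t - 2 * C * g * v a) * (v a * y a) + t * (y a)\<^sup>2) \<ge> 0"
  proof (rule sum_nonneg)
    fix a assume a: "a \<in> U"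
    have cg: "C * g \<ge> 0" using U C by (simp add: g_def)
    have v1: "- 1 / b \<le> v a" "v a \<le> 1 - 1 / b" using p(1)[OF a] p1[OF a] by (auto simp: v_def)
    have gb: "g * (1 / b) = 1 / (b - 2)" using b0 by (simp add: g_def)
    \<comment> \<open>The coefficient is affine in \<open>v a\<close>, so it is extremal at
      \<open>p a = 0\<close> and \<open>p a = 1\<close>; these ends are the two clauses of
      \<open>admissible\<close>.\<close>
    have "(2 * C - t - 2 * C * g * v a)\<^sup>2 \<le> 4 * t * C"
    proof (rule square_le_of_bounds)
      have "2 * (C * g) * (- 1 / b) \<le> 2 * (C * g) * v a" using v1 cg by (intro mult_left_mono) auto
      moreover have "2 * (C * g) * (- 1 / b) = - 2 * C / (b - 2)" using b0 by (simp add: g_def)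
      moreover have "(b - 1) / (b - 2) = 1 + 1 / (b - 2)" using U(3) by (simp add: field_simps)
      ultimately show "2 * C - t - 2 * C * g * v a \<le> 2 * C * ((b - 1) / (b - 2)) - t"
        by (simp add: algebra_simps)
      have "2 * (C * g) * v a \<le> 2 * (C * g) * (1 - 1 / b)" using v1 cg by (intro mult_left_mono) auto
      moreover have "2 * (C * g) * (1 - 1 / b) = 2 * C + 2 * C / (b - 2)"
        using U(3) b0 by (simp add: g_def field_simps)
      ultimately show "- (t + 2 * C / (b - 2)) \<le> 2 * C - t - 2 * C * g * v a"
        by (simp add: algebra_simps)
    qed (use adm in \<open>auto simp: admissible_def\<close>)
    thus "0 \<le> C * (v a)\<^sup>2 + (2 * C - t - 2 * C * g * v a) * (v a * y a) + t * (y a)\<^sup>2"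
      using t by (intro binary_quadratic_nonneg) auto
  qed
  also have "(\<Sum>a\<in>U. C * (v a)\<^sup>2 + (2 * C - t - 2 * C * g * v a) * (v a * y a) + t * (y a)\<^sup>2)
    = C * (\<Sum>a\<in>U. (v a)\<^sup>2) + (2 * C - t) * (\<Sum>a\<in>U. v a * y a) - 2 * C * g * (\<Sum>a\<in>U. (v a)\<^sup>2 * y a)
      + t * (\<Sum>a\<in>U. (y a)\<^sup>2)"
    unfolding sum_distrib_left sum.distrib[symmetric] sum_subtractf[symmetric]
    by (intro sum.cong refl) (simp add: power2_eq_square algebra_simps)
  also have "(\<Sum>a\<in>U. (v a)\<^sup>2) = s - 1 / b"
  proof -
    have "(\<Sum>a\<in>U. (v a)\<^sup>2) = (\<Sum>a\<in>U. (p a)\<^sup>2 - (2 / b) * p a + 1 / b\<^sup>2)"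
      using b0 by (intro sum.cong refl) (simp add: v_def power2_eq_square field_simps)
    also have "\<dots> = s - (2 / b) * sum p U + real (card U) / b\<^sup>2"
      by (simp add: sum.distrib sum_subtractf sum_distrib_left s_def)
    finally show ?thesis using b0 p(2) cb by (simp add: power2_eq_square)
  qed
  also have "(\<Sum>a\<in>U. (y a)\<^sup>2) = Q - 1 / b"
  proof -
    have "(\<Sum>a\<in>U. (y a)\<^sup>2) = (\<Sum>a\<in>U. (q a)\<^sup>2 - (2 / b) * q a + 1 / b\<^sup>2)"
      using b0 by (intro sum.cong refl) (simp add: y_def power2_eq_square field_simps)
    also have "\<dots> = Q - (2 / b) * sum q U + real (card U) / b\<^sup>2"
      by (simp add: sum.distrib sum_subtractf sum_distrib_left Q_def)
    finally show ?thesis using b0 q1 cb by (simp add: power2_eq_square)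
  qed
  also have "(\<Sum>a\<in>U. v a * y a) = \<pi> - 1 / b"
  proof -
    have "(\<Sum>a\<in>U. v a * y a) = (\<Sum>a\<in>U. p a * q a - (1 / b) * p a - (1 / b) * q a + 1 / b\<^sup>2)"
      using b0 by (intro sum.cong refl) (simp add: y_def v_def power2_eq_square field_simps)
    also have "\<dots> = \<pi> - (1 / b) * sum p U - (1 / b) * sum q U + real (card U) / b\<^sup>2"
      by (simp add: sum.distrib sum_subtractf sum_distrib_left \<pi>_def)
    finally show ?thesis using b0 p(2) q1 cb by (simp add: power2_eq_square)
  qed
  also have "(\<Sum>a\<in>U. (v a)\<^sup>2 * y a) = M - s / b - 2 * \<pi> / b + 2 / b\<^sup>2"
  proof -
    have "(\<Sum>a\<in>U. (v a)\<^sup>2 * y a) = (\<Sum>a\<in>U. q a * (p a)\<^sup>2 - (1 / b) * (p a)\<^sup>2 - (2 / b) * (p a * q a)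
         + (2 / b\<^sup>2) * p a + (1 / b\<^sup>2) * q a - 1 / b ^ 3)"
      using b0 by (intro sum.cong refl) (simp add: y_def v_def power2_eq_square power3_eq_cube field_simps)
    also have "\<dots> = M - (1 / b) * s - (2 / b) * \<pi> + (2 / b\<^sup>2) * sum p U + (1 / b\<^sup>2) * sum q U
         - real (card U) / b ^ 3"
      by (simp add: sum.distrib sum_subtractf sum_distrib_left \<pi>_def M_def s_def)
    finally show ?thesis using b0 p(2) q1 cb by (simp add: power2_eq_square power3_eq_cube)
  qed
  finally have *: "0 \<le> C * (s - 1 / b) + (2 * C - t) * (\<pi> - 1 / b)
     - 2 * C * g * (M - s / b - 2 * \<pi> / b + 2 / b\<^sup>2) + t * (Q - 1 / b)" .
  have m2: "mixed_sum p q 2 U = 1 - s - 2 * \<pi> + 2 * M"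
    using mixed_sum_2[OF U(1) p(2) q1] by (simp add: s_def \<pi>_def M_def)
  have "t * (b / (b - 1)) * (Q - \<pi>) - C * (b\<^sup>2 / ((b - 1) * (b - 2)) * mixed_sum p q 2 U - 1)
     = b / (b - 1) * (C * (s - 1 / b) + (2 * C - t) * (\<pi> - 1 / b)
     - 2 * C * g * (M - s / b - 2 * \<pi> / b + 2 / b\<^sup>2) + t * (Q - 1 / b))"
    unfolding m2 g_def using U(3) b0 by (simp add: divide_simps power2_eq_square) (simp add: algebra_simps)
  also have "\<dots> \<ge> 0" using * U(3) by (intro mult_nonneg_nonneg) auto
  finally show ?thesis by (simp add: Q_def \<pi>_def)
qed

text \<open>For odd \<open>m\<close> the power \<open>X\<^bsup>m/2\<^esup>\<close> is first bounded by the mean of the two neighbouring integral powers.\<close>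
definition chord_slope :: "real \<Rightarrow> nat \<Rightarrow> real" where
  "chord_slope B m = ((\<Sum>i<m div 2. B ^ i) + (\<Sum>i<(m + 1) div 2. B ^ i)) / 2"

text \<open>On \<open>[1, B]\<close> the convex function \<open>X^j\<close> lies below its chord,
  whose slope is the geometric sum of the \<open>B^i\<close>. With \<open>j\<close> and
  \<open>j'\<close> the two halves of \<open>m\<close>, the square root of \<open>X^j * X^j'\<close>
  is at most the arithmetic mean of these powers.\<close>

lemma le_chord:
  fixes X \<Psi> B :: real
  assumes X: "1 \<le> X" "X \<le> B" and \<Psi>: "\<Psi>\<^sup>2 \<le> X ^ m"
  shows "\<Psi> \<le> 1 + chord_slope B m * (X - 1)"
proof -
  have pw: "X ^ j \<le> 1 + (\<Sum>i<j. B ^ i) * (X - 1)" for j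
  proof -
    have "X ^ j - 1 = (X - 1) * (\<Sum>i<j. X ^ i)" by (rule power_diff_1_eq)
    also have "\<dots> \<le> (X - 1) * (\<Sum>i<j. B ^ i)"
      using X by (intro mult_left_mono sum_mono power_mono) auto
    finally show ?thesis by (simp add: mult.commute)
  qed
  define j j' where "j = m div 2" and "j' = (m + 1) div 2"
  have m: "m = j + j'" by (simp add: j_def j'_def)
  have "\<Psi>\<^sup>2 \<le> X ^ j * X ^ j'" using \<Psi> by (simp add: m power_add)
  also have "\<dots> \<le> ((X ^ j + X ^ j') / 2)\<^sup>2"
  proof -
    have "0 \<le> ((X ^ j - X ^ j') / 2)\<^sup>2" by simp
    thus ?thesis by (simp add: power2_eq_square field_simps)
  qed
  finally have "\<Psi> \<le> (X ^ j + X ^ j') / 2"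
    by (rule power2_le_imp_le) (use X in auto)
  also have "\<dots> \<le> ((1 + (\<Sum>i<j. B ^ i) * (X - 1)) + (1 + (\<Sum>i<j'. B ^ i) * (X - 1))) / 2"
    using pw[of j] pw[of j'] by simp
  also have "\<dots> = 1 + chord_slope B m * (X - 1)"
    by (simp add: chord_slope_def j_def j'_def field_simps)
  finally show ?thesis .
qed

text \<open>The value of \<^const>\<open>mixed_sum\<close> when both arguments are the uniform distribution on \<open>b\<close> symbols.\<close>
definition uniform_prob :: "nat \<Rightarrow> nat \<Rightarrow> real" where
  "uniform_prob b m = fact m * real (b - 1 choose m) / real b ^ m"

text \<open>\<open>X\<close> and \<open>\<Psi>\<close> are the probabilities for two and for
  \<open>m\<close> symbols with law \<open>p\<close>, divided by their values at the uniform law.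
  Maclaurin gives \<open>\<Psi>^2 <= X^m\<close>. If \<open>X >= 1\<close> the chord of slope at
  most \<open>C\<close> is used, and if \<open>X < 1\<close> the line of slope 1; hence the two
  admissibility hypotheses.\<close>

lemma mixed_sum_le:
  fixes p q :: "nat \<Rightarrow> real" and C t :: real and b m :: nat
  assumes U: "finite U" "card U = b" and m: "2 \<le> m" "m < b"
    and p: "\<And>i. i \<in> U \<Longrightarrow> p i \<ge> 0" "sum p U = 1" and q: "\<And>i. i \<in> U \<Longrightarrow> q i \<ge> 0" "sum q U = 1"
    and t: "t > 0" and C: "C \<ge> chord_slope ((real b / (real b - 1))\<^sup>2) m"
    and adm: "admissible b C t" "admissible b 1 t"
  shows "mixed_sum p q m U \<le> uniform_prob b m *
     (1 + t * (real b / (real b - 1)) * ((\<Sum>a\<in>U. (q a)\<^sup>2) - (\<Sum>a\<in>U. p a * q a)))"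
proof -
  define N where "N = b - 1"
  have bN: "b = Suc N" "card U = Suc N" using m U by (auto simp: N_def)
  have b2: "real b > 2" using m by simp
  define \<beta> where "\<beta> = real b / (real b - 1)"
  define R where "R = (\<Sum>a\<in>U. (q a)\<^sup>2) - (\<Sum>a\<in>U. p a * q a)"
  define \<mu> where "\<mu> = (\<lambda>k. mixed_sum p q k U / (fact k * real (N choose k)))"
  have mN: "m \<le> N" using m bN by simp
  have mac: "(\<mu> m)\<^sup>2 \<le> \<mu> 2 ^ m" "\<mu> 2 \<le> (\<mu> 1)\<^sup>2" "\<mu> 2 \<ge> 0"
    unfolding \<mu>_def using mixed_sum_maclaurin[of U N p q m, OF U(1) bN(2) p(1) q(1) q(2) m(1) mN] by simp_all
  define X where "X = (real b)\<^sup>2 * \<mu> 2"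
  define \<Psi> where "\<Psi> = real b ^ m * \<mu> m"
  have X_eq: "X = (real b)\<^sup>2 / ((real b - 1) * (real b - 2)) * mixed_sum p q 2 U"
  proof -
    have "real (2 * (N choose 2)) = real N * (real N - 1)"
      using m bN by (simp add: choose_two of_nat_diff)
    hence "fact 2 * real (N choose 2) = (real b - 1) * (real b - 2)"
      using bN by (simp add: fact_2)
    thus ?thesis by (simp add: X_def \<mu>_def)
  qed
  have X0: "X \<ge> 0" using mac(3) by (simp add: X_def)
  have \<Psi>X: "\<Psi>\<^sup>2 \<le> X ^ m"
    using mult_left_mono[OF mac(1), of "(real b ^ m)\<^sup>2"]
    by (simp add: \<Psi>_def X_def power_mult_distrib power_mult[symmetric] mult.commute)
  \<comment> \<open>The chord needs a right end for the range of \<open>X\<close>. It comes from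
    Maclaurin between orders 2 and 1, as the probability of order 1 is at most 1.\<close>
  have XB: "X \<le> \<beta>\<^sup>2"
  proof -
    have "mixed_sum p q 1 U \<le> 1"
      using mixed_sum_1[OF U(1) p(2) q(2)] p(1) q(1) by (simp add: sum_nonneg)
    moreover have "mixed_sum p q 1 U \<ge> 0"
      unfolding mixed_sum_def using p(1) q(1) by (auto intro!: sum_nonneg mult_nonneg_nonneg)
    ultimately have "(real b * \<mu> 1)\<^sup>2 \<le> (real b * (1 / real N))\<^sup>2"
      by (intro power_mono mult_left_mono) (auto simp: \<mu>_def intro!: divide_right_mono)
    moreover have "X \<le> (real b * \<mu> 1)\<^sup>2"
      using mult_left_mono[OF mac(2), of "(real b)\<^sup>2"] by (simp add: X_def power_mult_distrib)
    moreover have "real b * (1 / real N) = \<beta>" using bN by (simp add: \<beta>_def)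
    ultimately show ?thesis by simp
  qed
  have "\<Psi> \<le> 1 + t * \<beta> * R"
  proof (cases "X \<ge> 1")
    case True
    have cs: "chord_slope (\<beta>\<^sup>2) m \<ge> 0"
      unfolding chord_slope_def by (auto intro!: add_nonneg_nonneg sum_nonneg)
    have "\<Psi> \<le> 1 + chord_slope (\<beta>\<^sup>2) m * (X - 1)" by (rule le_chord[OF True XB \<Psi>X])
    also have "\<dots> \<le> 1 + C * (X - 1)" using C True by (simp add: \<beta>_def mult_right_mono)
    also have "C * (X - 1) \<le> t * \<beta> * R"
      unfolding X_eq \<beta>_def R_def
      using U p q t C cs adm b2 by (intro scaled_mixed_sum_2_le) (auto simp: \<beta>_def)
    finally show ?thesis by simp
  next
    case False
    \<comment> \<open>Below 1 a higher power only helps, so \<open>m >= 2\<close> leaves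
      \<open>\<Psi> <= X\<close>.\<close>
    have "X ^ m \<le> X\<^sup>2" using False X0 m by (intro power_decreasing) auto
    hence "\<Psi>\<^sup>2 \<le> X\<^sup>2" using \<Psi>X by linarith
    hence "\<Psi> \<le> X" by (rule power2_le_imp_le) (rule X0)
    also have "1 * (X - 1) \<le> t * \<beta> * R"
      unfolding X_eq \<beta>_def R_def
      using U p q t adm b2 by (intro scaled_mixed_sum_2_le) auto
    hence "X \<le> 1 + t * \<beta> * R" by simp
    finally show ?thesis .
  qed
  moreover have "mixed_sum p q m U = uniform_prob b m * \<Psi>"
    using mN bN by (simp add: uniform_prob_def \<Psi>_def \<mu>_def)
  moreover have "uniform_prob b m \<ge> 0" by (simp add: uniform_prob_def)
  ultimately show ?thesis by (simp add: mult_left_mono \<beta>_def R_def)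
qed

text \<open>The bound of \<open>mixed_sum_le\<close> is affine in \<open>p\<close>, and the weighted
  mean of the laws \<open>p i\<close> is \<open>q\<close>; so the correction averages to
  \<open>|q|^2 - |q|^2 = 0\<close>. Indices of weight 0 are exempt because an empty cell has no
  symbol law.\<close>

lemma average_mixed_sum_le:
  fixes p :: "'i \<Rightarrow> nat \<Rightarrow> real" and q :: "nat \<Rightarrow> real" and C t :: real and b m :: nat
  assumes U: "finite U" "card U = b" and m: "2 \<le> m" "m < b"
    and w: "finite I" "\<And>i. i \<in> I \<Longrightarrow> w i \<ge> 0"
    and p: "\<And>i a. i \<in> I \<Longrightarrow> w i \<noteq> 0 \<Longrightarrow> a \<in> U \<Longrightarrow> p i a \<ge> 0"
      "\<And>i. i \<in> I \<Longrightarrow> w i \<noteq> 0 \<Longrightarrow> sum (p i) U = 1"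
    and q: "\<And>a. a \<in> U \<Longrightarrow> q a \<ge> 0" "sum q U = 1"
    and mean: "\<And>a. a \<in> U \<Longrightarrow> (\<Sum>i\<in>I. w i * p i a) = sum w I * q a"
    and t: "t > 0" and C: "C \<ge> chord_slope ((real b / (real b - 1))\<^sup>2) m"
    and adm: "admissible b C t" "admissible b 1 t"
  shows "(\<Sum>i\<in>I. w i * mixed_sum (p i) q m U) \<le> uniform_prob b m * sum w I"
proof -
  define T where "T = t * (real b / (real b - 1))"
  define Q where "Q = (\<Sum>a\<in>U. (q a)\<^sup>2)"
  have "(\<Sum>i\<in>I. w i * mixed_sum (p i) q m U)
      \<le> (\<Sum>i\<in>I. w i * (uniform_prob b m * (1 + T * (Q - (\<Sum>a\<in>U. p i a * q a)))))"
  proof (rule sum_mono)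
    fix i assume i: "i \<in> I"
    show "w i * mixed_sum (p i) q m U \<le> w i * (uniform_prob b m * (1 + T * (Q - (\<Sum>a\<in>U. p i a * q a))))"
    proof (cases "w i = 0")
      case False
      thus ?thesis unfolding T_def Q_def
        using mixed_sum_le[OF U m, of "p i" q t C] p[OF i False] q t C adm w(2)[OF i]
        by (intro mult_left_mono) auto
    qed simp
  qed
  also have "\<dots> = uniform_prob b m * ((1 + T * Q) * sum w I - T * (\<Sum>i\<in>I. w i * (\<Sum>a\<in>U. p i a * q a)))"
  proof -
    have "(\<Sum>i\<in>I. w i * (uniform_prob b m * (1 + T * (Q - S i))))
       = uniform_prob b m * ((1 + T * Q) * sum w I - T * (\<Sum>i\<in>I. w i * S i))" for S
      unfolding sum_distrib_left sum_subtractf[symmetric]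
      by (intro sum.cong refl) (simp add: algebra_simps)
    thus ?thesis .
  qed
  also have "(\<Sum>i\<in>I. w i * (\<Sum>a\<in>U. p i a * q a)) = (\<Sum>a\<in>U. q a * (\<Sum>i\<in>I. w i * p i a))"
    unfolding sum_distrib_left by (subst sum.swap) (simp add: mult_ac)
  also have "\<dots> = sum w I * Q"
    using mean by (simp add: Q_def sum_distrib_left power2_eq_square mult_ac)
  finally show ?thesis by (simp add: algebra_simps)
qed

section \<open>Hansel's inequality\<close>

text \<open>Draw a colour \<open>c i\<close> from each \<open>K i\<close> and keep the vertices
  whose colour agrees with it wherever they lie in \<open>W i\<close>. By separation at most one
  vertex survives. A vertex lying in \<open>d\<close> of the sets survives with probability
  \<open>r^(-d)\<close>, so these numbers sum to at most 1, and convexity of the exponential gives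
  the bound.\<close>

lemma hansel_inequality:
  fixes V :: "'v set" and W :: "nat \<Rightarrow> 'v set" and col :: "nat \<Rightarrow> 'v \<Rightarrow> 'c" and K :: "nat \<Rightarrow> 'c set"
  assumes V: "finite V" "V \<noteq> {}" and r: "r \<ge> 1"
    and K: "\<And>i. i < n \<Longrightarrow> finite (K i)" "\<And>i. i < n \<Longrightarrow> card (K i) = r"
    and W: "\<And>i. i < n \<Longrightarrow> W i \<subseteq> V" "\<And>i y. i < n \<Longrightarrow> y \<in> W i \<Longrightarrow> col i y \<in> K i"
    and sep: "\<And>y z. y \<in> V \<Longrightarrow> z \<in> V \<Longrightarrow> y \<noteq> z \<Longrightarrow> \<exists>i<n. y \<in> W i \<and> z \<in> W i \<and> col i y \<noteq> col i z"
  shows "real (card V) * ln (real (card V)) \<le> ln (real r) * (\<Sum>i<n. real (card (W i)))"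
proof -
  define P where "P = PiE {..<n} K"
  define d where "d y = (\<Sum>i<n. of_bool (y \<in> W i) :: real)" for y
  define L where "L = ln (real r)"
  define N where "N = real (card V)"
  have N0: "N > 0" using V by (simp add: N_def card_gt_0_iff)
  have Pf: "finite P" unfolding P_def using K by (intro finite_PiE) auto
  have Pc: "real (card P) = exp (real n * L)"
    using K r by (simp add: P_def card_PiE L_def exp_of_nat_mult)
  define surv where "surv y c \<longleftrightarrow> (\<forall>i<n. y \<in> W i \<longrightarrow> col i y = c i)" for y c
  have one: "card {y\<in>V. surv y c} \<le> 1" for c
  proof -
    have "y = z" if yz: "y \<in> V" "z \<in> V" "surv y c" "surv z c" for y z
    proof (rule ccontr)
      assume "y \<noteq> z"
      then obtain i where "i < n" "y \<in> W i" "z \<in> W i" "col i y \<noteq> col i z" using sep yz by blast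
      thus False using yz by (auto simp: surv_def)
    qed
    thus ?thesis using V by (simp add: card_le_Suc0_iff_eq)
  qed
  have cnt: "real (card {c\<in>P. surv y c}) = exp (real n * L - L * d y)" for y
  proof -
    have "{c\<in>P. surv y c} = PiE {..<n} (\<lambda>i. if y \<in> W i then {col i y} else K i)"
    proof (rule set_eqI)
      fix c
      have "c i \<in> (if y \<in> W i then {col i y} else K i) \<longleftrightarrow> c i \<in> K i \<and> (y \<in> W i \<longrightarrow> col i y = c i)"
        if "i < n" for i
        using W(2)[OF that, of y] by auto
      hence "(\<forall>i\<in>{..<n}. c i \<in> (if y \<in> W i then {col i y} else K i)) \<longleftrightarrow>
          (\<forall>i\<in>{..<n}. c i \<in> K i) \<and> (\<forall>i<n. y \<in> W i \<longrightarrow> col i y = c i)"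
        unfolding lessThan_iff Ball_def by blast
      thus "c \<in> {c \<in> P. surv y c} \<longleftrightarrow> c \<in> PiE {..<n} (\<lambda>i. if y \<in> W i then {col i y} else K i)"
        unfolding P_def surv_def PiE_iff mem_Collect_eq by blast
    qed
    hence "real (card {c\<in>P. surv y c}) = (\<Prod>i<n. real (card (if y \<in> W i then {col i y} else K i)))"
      by (simp add: card_PiE)
    also have "\<dots> = (\<Prod>i<n. exp (L - L * of_bool (y \<in> W i)))"
      using K r by (intro prod.cong) (auto simp: L_def)
    also have "\<dots> = exp (\<Sum>i<n. L - L * of_bool (y \<in> W i))" by (simp add: exp_sum)
    also have "(\<Sum>i<n. L - L * of_bool (y \<in> W i)) = real n * L - L * d y"
      unfolding d_def by (simp only: sum_subtractf sum_distrib_left) simp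
    finally show ?thesis .
  qed
  have "(\<Sum>y\<in>V. real (card {c\<in>P. surv y c})) = (\<Sum>c\<in>P. real (card {y\<in>V. surv y c}))"
    using sum.swap_restrict[OF V(1) Pf, of "\<lambda>_ _. 1 :: real" surv] by simp
  also have "\<dots> \<le> (\<Sum>c\<in>P. 1)" using one by (intro sum_mono) auto
  also have "\<dots> = exp (real n * L)" using Pc by simp
  finally have "(\<Sum>y\<in>V. exp (real n * L) * exp (- (L * d y))) \<le> exp (real n * L)"
    unfolding cnt by (simp add: exp_diff exp_minus divide_inverse)
  hence le1: "(\<Sum>y\<in>V. exp (- (L * d y))) \<le> 1"
    by (simp add: sum_distrib_left[symmetric])
  define D where "D = (\<Sum>y\<in>V. d y) / N"
  \<comment> \<open>Jensen's inequality by the tangent at the mean \<open>D\<close>: the linear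
    terms cancel in the sum.\<close>
  have "N * exp (- (L * D)) = (\<Sum>y\<in>V. exp (- (L * D)) * (1 - L * (d y - D)))"
  proof -
    have "(\<Sum>y\<in>V. 1 - L * (d y - D)) = N - L * ((\<Sum>y\<in>V. d y) - N * D)"
      by (simp add: sum_subtractf sum_distrib_left[symmetric] N_def)
    also have "\<dots> = N" using N0 by (simp add: D_def)
    finally show ?thesis by (simp add: sum_distrib_left[symmetric] mult.commute)
  qed
  also have "\<dots> \<le> (\<Sum>y\<in>V. exp (- (L * d y)))"
  proof (rule sum_mono)
    fix y
    have "1 + (- (L * (d y - D))) \<le> exp (- (L * (d y - D)))" by (rule exp_ge_add_one_self)
    hence "exp (- (L * D)) * (1 - L * (d y - D)) \<le> exp (- (L * D)) * exp (- (L * (d y - D)))"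
      by (intro mult_left_mono) auto
    also have "\<dots> = exp (- (L * d y))" by (simp add: exp_add[symmetric] algebra_simps)
    finally show "exp (- (L * D)) * (1 - L * (d y - D)) \<le> exp (- (L * d y))" .
  qed
  finally have "N * exp (- (L * D)) \<le> 1" using le1 by linarith
  hence "N \<le> exp (L * D)" by (simp add: exp_minus field_simps)
  hence "ln N \<le> L * D" using N0 by (metis ln_exp ln_le_cancel_iff exp_gt_zero)
  hence "N * ln N \<le> N * (L * D)" using N0 by (intro mult_left_mono) auto
  also have "\<dots> = L * (\<Sum>y\<in>V. d y)" using N0 by (simp add: D_def)
  also have "(\<Sum>y\<in>V. d y) = (\<Sum>i<n. real (card (W i)))"
  proof -
    have "(\<Sum>y\<in>V. d y) = (\<Sum>i<n. \<Sum>y\<in>V. of_bool (y \<in> W i))"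
      unfolding d_def by (rule sum.swap)
    also have "\<dots> = (\<Sum>i<n. real (card (W i)))"
    proof (intro sum.cong refl)
      fix i assume "i \<in> {..<n}"
      hence "V \<inter> W i = W i" using W by auto
      thus "(\<Sum>y\<in>V. of_bool (y \<in> W i)) = real (card (W i))"
        using V by (simp add: sum.inter_restrict[symmetric] of_bool_def sum.If_cases)
    qed
    finally show ?thesis .
  qed
  finally show ?thesis by (simp add: N_def L_def)
qed

section \<open>Hansel's inequality for the symbol graphs of a code\<close>

definition symbol_freq :: "nat list set \<Rightarrow> nat \<Rightarrow> nat \<Rightarrow> real" where
  "symbol_freq C i a = real (card {x\<in>C. x ! i = a}) / real (card C)"

text \<open>The fraction of non-isolated vertices in the graph that coordinate \<open>i\<close> contributes to Hansel's
  inequality once the words \<open>xs\<close> are fixed.\<close>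
definition avoid :: "nat \<Rightarrow> (nat \<Rightarrow> real) \<Rightarrow> nat \<Rightarrow> nat list list \<Rightarrow> real" where
  "avoid b q i xs = (if distinct (map (\<lambda>x. x ! i) xs) \<and> set (map (\<lambda>x. x ! i) xs) \<subseteq> {1..b}
     then sum q ({1..b} - set (map (\<lambda>x. x ! i) xs)) else 0)"

text \<open>Two further words \<open>y\<close>, \<open>z\<close> together with \<open>xs\<close>
  form a set of size \<open>k\<close>. The coordinate separating this set is good, and there both
  symbols avoid those of \<open>xs\<close> and differ. So the graphs with \<open>b - m\<close>
  colours meet the hypothesis of \<open>hansel_inequality\<close>.\<close>

lemma hash_code_hansel:
  assumes C: "is_hash_code b k n C" "finite C" and k: "k = m + 2" "m < b"
    and xs: "length xs = m" "distinct xs" "set xs \<subseteq> C" and big: "card C > m"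
  shows "real (card C - m) * ln (real (card C - m))
      \<le> ln (real (b - m)) * real (card C) * (\<Sum>i<n. avoid b (symbol_freq C i) i xs)"
proof -
  define h where "h i = (\<lambda>x::nat list. x ! i)" for i
  define good where "good i \<longleftrightarrow> distinct (map (h i) xs)" for i
  define V where "V = C - set xs"
  \<comment> \<open>At a coordinate where \<open>xs\<close> has a repeated symbol no vertex takes
    part; \<open>{1..b - m}\<close> is a placeholder with the required number of colours.\<close>
  define K where "K i = (if good i then {1..b} - set (map (h i) xs) else {1..b - m})" for i
  define W where "W i = (if good i then {y\<in>V. h i y \<notin> set (map (h i) xs)} else {})" for i
  have words: "C \<subseteq> words b n" using C by (simp add: is_hash_code_def)
  have sym: "h i x \<in> {1..b}" if "x \<in> C" "i < n" for x i
  proof -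
    have "length x = n" "set x \<subseteq> {1..b}" using that words by (auto simp: words_def)
    thus ?thesis using that nth_mem[of i x] unfolding h_def by blast
  qed
  have sxs: "set (map (h i) xs) \<subseteq> {1..b}" if "i < n" for i using sym that xs by auto
  have cxs: "card (set xs) = m" using xs by (simp add: distinct_card)
  have cV: "card V = card C - m" using xs C cxs by (simp add: V_def card_Diff_subset)
  have "real (card V) * ln (real (card V)) \<le> ln (real (b - m)) * (\<Sum>i<n. real (card (W i)))"
  proof (rule hansel_inequality[where K = K and col = h])
    show "finite V" using C by (simp add: V_def)
    show "V \<noteq> {}" using big cV by auto
    show "b - m \<ge> 1" using k by simp
    fix i assume i: "i < n"
    show "finite (K i)" by (simp add: K_def)
    show "card (K i) = b - m"
    proof (cases "good i")
      case True
      hence "card (set (map (h i) xs)) = m" using xs by (metis good_def distinct_card length_map)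
      thus ?thesis using True sxs[OF i] by (simp add: K_def card_Diff_subset)
    qed (simp add: K_def)
    show "W i \<subseteq> V" by (auto simp: W_def)
    show "h i y \<in> K i" if "y \<in> W i" for y
      using that sym[of y i] i by (auto simp: W_def K_def V_def split: if_splits)
  next
    fix y z assume yz: "y \<in> V" "z \<in> V" "y \<noteq> z"
    define S where "S = insert y (insert z (set xs))"
    have "card S = k" using yz cxs k by (simp add: S_def V_def)
    moreover have "S \<subseteq> C" using yz xs by (auto simp: S_def V_def)
    ultimately obtain i where i: "i < n" "inj_on (h i) S"
      using C by (auto simp: is_hash_code_def h_def)
    have "good i" using i xs unfolding good_def distinct_map
      by (auto intro: inj_on_subset simp: S_def)
    moreover have "h i y \<noteq> h i z" using i yz by (auto simp: S_def inj_on_def)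
    moreover have "h i y \<notin> set (map (h i) xs)" "h i z \<notin> set (map (h i) xs)"
      using i yz unfolding S_def V_def by (auto simp: inj_on_def)
    ultimately show "\<exists>i<n. y \<in> W i \<and> z \<in> W i \<and> h i y \<noteq> h i z"
      using i yz by (auto simp: W_def)
  qed
  also have "\<dots> \<le> ln (real (b - m)) * (\<Sum>i<n. real (card C) * avoid b (symbol_freq C i) i xs)"
  proof (intro mult_left_mono sum_mono)
    fix i assume i: "i \<in> {..<n}"
    show "real (card (W i)) \<le> real (card C) * avoid b (symbol_freq C i) i xs"
    proof (cases "good i")
      case True
      define A where "A = {1..b} - set (map (h i) xs)"
      have "W i \<subseteq> (\<Union>a\<in>A. {x\<in>C. x ! i = a})"
        using True i sym by (auto simp: W_def A_def V_def h_def)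
      hence "card (W i) \<le> card (\<Union>a\<in>A. {x\<in>C. x ! i = a})"
        using C by (intro card_mono) (auto simp: A_def)
      also have "\<dots> \<le> (\<Sum>a\<in>A. card {x\<in>C. x ! i = a})" by (intro card_UN_le) (simp add: A_def)
      finally have "real (card (W i)) \<le> (\<Sum>a\<in>A. real (card {x\<in>C. x ! i = a}))"
        by (simp flip: of_nat_sum)
      also have "\<dots> = real (card C) * sum (symbol_freq C i) A"
        using big by (simp add: symbol_freq_def sum_divide_distrib[symmetric])
      finally show ?thesis using True i sxs[of i] by (simp add: avoid_def A_def good_def h_def)
    next
      case False
      thus ?thesis by (auto simp: W_def avoid_def symbol_freq_def intro!: mult_nonneg_nonneg sum_nonneg)
    qed
  qed (use k in auto)
  finally show ?thesis by (simp add: cV sum_distrib_left mult_ac)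
qed

text \<open>The head of the list uses up its symbol, so the tail faces \<open>U\<close> without it.
  Lists with repeated words are included, since the \<open>m\<close> words are drawn
  independently.\<close>

lemma sum_lists_avoid:
  fixes h :: "'a \<Rightarrow> nat"
  assumes "finite D" "finite U"
  shows "(\<Sum>xs | set xs \<subseteq> D \<and> length xs = m.
            if distinct (map h xs) \<and> set (map h xs) \<subseteq> U then sum q (U - set (map h xs)) else 0)
       = mixed_sum (\<lambda>a. real (card {x\<in>D. h x = a})) q m U"
  using assms(2)
proof (induction m arbitrary: U)
  case 0
  have "{xs. set xs \<subseteq> D \<and> length xs = 0} = {[]}" by auto
  thus ?case by (simp add: mixed_sum_0)
next
  case (Suc m)
  define G where "G U xs = (if distinct (map h xs) \<and> set (map h xs) \<subseteq> U
     then sum q (U - set (map h xs)) else 0 :: real)" for U xs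
  define Ls where "Ls = {xs. set xs \<subseteq> D \<and> length xs = m}"
  define c where "c = (\<lambda>a. real (card {x\<in>D. h x = a}))"
  have split: "G U (x # xs) = (if h x \<in> U then G (U - {h x}) xs else 0)" for x xs
  proof -
    have e: "U - set (map h (x # xs)) = (U - {h x}) - set (map h xs)" by auto
    have c: "distinct (map h (x # xs)) \<and> set (map h (x # xs)) \<subseteq> U \<longleftrightarrow>
       h x \<in> U \<and> distinct (map h xs) \<and> set (map h xs) \<subseteq> U - {h x}"
      unfolding list.map distinct.simps list.set(2) by blast
    show ?thesis unfolding G_def e c by simp
  qed
  have "(\<Sum>xs | set xs \<subseteq> D \<and> length xs = Suc m. G U xs)
      = (\<Sum>(xs, x)\<in>Ls \<times> D. G U (x # xs))"
    unfolding lists_length_Suc_eq Ls_def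
    by (subst sum.reindex) (auto simp: inj_on_def case_prod_unfold)
  also have "\<dots> = (\<Sum>x\<in>D. \<Sum>xs\<in>Ls. G U (x # xs))"
    by (subst sum.cartesian_product[symmetric], subst sum.swap) simp
  also have "\<dots> = (\<Sum>x\<in>D. if h x \<in> U then mixed_sum c q m (U - {h x}) else 0)"
  proof (intro sum.cong refl)
    fix x assume "x \<in> D"
    have "(\<Sum>xs\<in>Ls. G (U - {h x}) xs) = mixed_sum c q m (U - {h x})"
      using Suc.IH[of "U - {h x}"] Suc.prems unfolding G_def Ls_def c_def by blast
    thus "(\<Sum>xs\<in>Ls. G U (x # xs)) = (if h x \<in> U then mixed_sum c q m (U - {h x}) else 0)"
      unfolding split by (cases "h x \<in> U") simp_all
  qed
  also have "\<dots> = (\<Sum>x\<in>D. \<Sum>a\<in>U. if h x = a then mixed_sum c q m (U - {a}) else 0)"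
    using Suc.prems by (intro sum.cong refl) (simp add: sum.delta')
  also have "\<dots> = (\<Sum>a\<in>U. \<Sum>x\<in>D. if h x = a then mixed_sum c q m (U - {a}) else 0)"
    by (rule sum.swap)
  also have "\<dots> = (\<Sum>a\<in>U. c a * mixed_sum c q m (U - {a}))"
    using assms(1) by (intro sum.cong refl) (simp add: c_def sum.If_cases Int_def)
  also have "\<dots> = mixed_sum c q (Suc m) U" using Suc.prems by (simp add: mixed_sum_Suc)
  finally show ?case by (simp add: G_def c_def)
qed

lemma inj_sum_scale: "inj_sum (\<lambda>a. s * p a) m U = s ^ m * inj_sum p m U"
  by (induction m arbitrary: U) (auto simp: sum_distrib_left mult_ac intro!: sum.cong)

lemma mixed_sum_scale: "mixed_sum (\<lambda>a. s * p a) q m U = s ^ m * mixed_sum p q m U"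
  by (simp add: mixed_sum_def inj_sum_scale sum_distrib_left mult_ac)

lemma sum_lists_avoid_freq:
  assumes D: "finite D" "D \<noteq> {}"
  shows "(\<Sum>xs | set xs \<subseteq> D \<and> length xs = m. avoid b q i xs)
       = real (card D) ^ m * mixed_sum (symbol_freq D i) q m {1..b}"
proof -
  have "(\<lambda>a. real (card {x\<in>D. x ! i = a})) = (\<lambda>a. real (card D) * symbol_freq D i a)"
    using D by (auto simp: symbol_freq_def)
  thus ?thesis
    using sum_lists_avoid[OF D(1), of "{1..b}" "\<lambda>x. x ! i" q m]
    by (simp add: avoid_def mixed_sum_scale)
qed

section \<open>Random boxes\<close>

lemma inj_sum_eq_0:
  assumes "finite S" "card S < m"
  shows "inj_sum p m S = 0"
  using assms
proof (induction m arbitrary: S)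
  case (Suc m)
  have "inj_sum p m (S - {a}) = 0" if "a \<in> S" for a
  proof -
    have "card S > 0" using that Suc.prems by (auto simp: card_gt_0_iff)
    thus ?thesis using Suc.prems that by (intro Suc.IH) auto
  qed
  thus ?case by simp
qed simp

lemma inj_sum_full:
  assumes "finite S" "card S = m"
  shows "inj_sum p m S = fact m * prod p S"
  using assms
proof (induction m arbitrary: S)
  case (Suc m)
  have "p a * inj_sum p m (S - {a}) = fact m * prod p S" if "a \<in> S" for a
    using Suc that by (simp add: prod.remove[of S a p] card_Diff_singleton)
  thus ?case using Suc.prems by simp
qed simp

lemma inj_sum_restrict:
  assumes "finite W" "\<And>a. a \<notin> S \<Longrightarrow> p a = 0"
  shows "inj_sum p m W = inj_sum p m (W \<inter> S)"
  using assms(1)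
proof (induction m arbitrary: W)
  case (Suc m)
  have "inj_sum p (Suc m) W = (\<Sum>a\<in>W. p a * inj_sum p m ((W - {a}) \<inter> S))"
    unfolding inj_sum.simps
    by (intro sum.cong refl arg_cong2[where f = "(*)"] Suc.IH) (use Suc.prems in auto)
  also have "\<dots> = (\<Sum>a\<in>W \<inter> S. p a * inj_sum p m ((W - {a}) \<inter> S))"
    using Suc.prems assms(2) by (intro sum.mono_neutral_right) auto
  also have "\<dots> = (\<Sum>a\<in>W \<inter> S. p a * inj_sum p m (W \<inter> S - {a}))"
    by (intro sum.cong refl arg_cong2[where f = "(*)"] arg_cong[where f = "inj_sum p m"]) auto
  finally show ?case by simp
qed simp

lemma prod_le_mean_power:
  fixes x :: "'a \<Rightarrow> real"
  assumes S: "finite S" "card S = m" "m > 0" and x: "\<And>i. i \<in> S \<Longrightarrow> x i \<ge> 0"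
  shows "prod x S \<le> (sum x S / real m) ^ m"
proof (cases "prod x S = 0")
  case True
  thus ?thesis using x by (simp add: sum_nonneg)
next
  case False
  have S': "S \<noteq> {}" using S by auto
  have pos: "prod x S > 0" using False x by (simp add: prod_nonneg less_le)
  have "prod x S powr (1 / real m) \<le> sum x S / real m"
    using arith_geom_mean[of S x] S S' x by (simp add: sum_divide_distrib)
  hence "(prod x S powr (1 / real m)) ^ m \<le> (sum x S / real m) ^ m"
    by (intro power_mono) auto
  moreover have "(y powr (1 / real m)) ^ m = y" if "y > 0" for y
    using that S(3) by (subst powr_realpow[symmetric]) (auto simp: powr_powr)
  ultimately show ?thesis using pos by simp
qed

text \<open>Since \<open>p\<close> lives on only \<open>m\<close> symbols, distinct draws must
  exhaust \<open>S\<close>, and the last symbol must fall outside \<open>S\<close>. By the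
  arithmetic-geometric mean inequality the draws exhaust \<open>S\<close> with probability at most
  \<open>m! / m^m\<close>.\<close>

lemma mixed_sum_supported_le:
  assumes U: "finite U" "S \<subseteq> U" and S: "card S = m" "m > 0"
    and p: "\<And>a. p a \<ge> 0" "\<And>a. a \<notin> S \<Longrightarrow> p a = 0" "sum p U = 1" and q: "\<And>a. a \<in> U \<Longrightarrow> q a \<ge> 0"
  shows "mixed_sum p q m U \<le> fact m / real m ^ m * sum q (U - S)"
proof -
  have Sf: "finite S" using U finite_subset by blast
  have p1: "sum p S = 1"
    using sum.mono_neutral_right[of U S p] U p by auto
  have "inj_sum p m (U - {c}) \<le> (if c \<in> S then 0 else fact m / real m ^ m)" if "c \<in> U" for c
  proof (cases "c \<in> S")
    case True
    have "(U - {c}) \<inter> S = S - {c}" using U by auto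
    hence "inj_sum p m (U - {c}) = inj_sum p m (S - {c})"
      using inj_sum_restrict[of "U - {c}" S p m] U(1) p(2) by simp
    also have "\<dots> = 0" using Sf S True by (intro inj_sum_eq_0) (auto simp: card_gt_0_iff)
    finally show ?thesis using True by simp
  next
    case False
    have "(U - {c}) \<inter> S = S" using U False by auto
    hence "inj_sum p m (U - {c}) = fact m * prod p S"
      using inj_sum_restrict[of "U - {c}" S p m] U(1) p(2) inj_sum_full[OF Sf S(1), of p] by simp
    also have "\<dots> \<le> fact m * (sum p S / real m) ^ m"
      using Sf S p by (intro mult_left_mono prod_le_mean_power) auto
    finally show ?thesis using False p1 by (simp add: power_divide)
  qed
  hence "mixed_sum p q m U \<le> (\<Sum>c\<in>U. q c * (if c \<in> S then 0 else fact m / real m ^ m))"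
    unfolding mixed_sum_def using q by (intro sum_mono mult_left_mono) auto
  also have "\<dots> = (\<Sum>c\<in>U - S. q c * (if c \<in> S then 0 else fact m / real m ^ m))"
    using U by (intro sum.mono_neutral_right) auto
  also have "\<dots> = (\<Sum>c\<in>U - S. fact m / real m ^ m * q c)"
    by (intro sum.cong) auto
  finally show ?thesis by (simp add: sum_distrib_left)
qed

lemma mixed_sum_nonneg:
  assumes "\<And>a. p a \<ge> 0" "\<And>a. q a \<ge> 0"
  shows "mixed_sum p q m U \<ge> 0"
proof -
  have "inj_sum p m W \<ge> 0" for W
    by (induction m arbitrary: W) (auto intro!: sum_nonneg mult_nonneg_nonneg assms)
  thus ?thesis unfolding mixed_sum_def by (auto intro!: sum_nonneg mult_nonneg_nonneg assms)
qed

lemma symbol_freq_nonneg: "symbol_freq D i a \<ge> 0"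
  by (simp add: symbol_freq_def)

lemma card_symbols:
  fixes D :: "nat list set"
  assumes "finite D" "\<And>x. x \<in> D \<Longrightarrow> x ! i \<in> {1..b}"
  shows "(\<Sum>a\<in>{1..b}. real (card {x\<in>D. x ! i = a})) = real (card D)"
proof -
  have "real (card D) = (\<Sum>x\<in>D. \<Sum>a\<in>{a\<in>{1..b}. x ! i = a}. 1)"
  proof -
    have "{a\<in>{1..b}. x ! i = a} = {x ! i}" if "x \<in> D" for x using assms(2)[OF that] by auto
    thus ?thesis by simp
  qed
  also have "\<dots> = (\<Sum>a\<in>{1..b}. \<Sum>x\<in>{x\<in>D. x ! i = a}. 1)"
    using assms(1) by (intro sum.swap_restrict) auto
  finally show ?thesis by simp
qed

lemma sum_symbol_freq:
  assumes "finite D" "D \<noteq> {}" "\<And>x. x \<in> D \<Longrightarrow> x ! i \<in> {1..b}"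
  shows "sum (symbol_freq D i) {1..b} = 1"
  using card_symbols[OF assms(1,3)] assms(1,2)
  unfolding symbol_freq_def sum_divide_distrib[symmetric] by simp

section \<open>Counting m-element sets of symbols\<close>

definition subsets_of_size :: "nat \<Rightarrow> nat \<Rightarrow> nat set set" where
  "subsets_of_size b m = {S. S \<subseteq> {1..b} \<and> card S = m}"

lemma finite_subsets_of_size [simp]: "finite (subsets_of_size b m)"
  by (rule finite_subset[of _ "Pow {1..b}"]) (auto simp: subsets_of_size_def)

lemma card_subsets_of_size: "card (subsets_of_size b m) = b choose m"
  using n_subsets[of "{1..b}" m] by (simp add: subsets_of_size_def)

lemma card_subsets_of_size_containing:
  assumes a: "a \<in> {1..b}" and m: "m > 0"
  shows "card {S \<in> subsets_of_size b m. a \<in> S} = (b - 1) choose (m - 1)"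
proof -
  have "bij_betw (insert a) {T. T \<subseteq> {1..b} - {a} \<and> card T = m - 1} {S \<in> subsets_of_size b m. a \<in> S}"
  proof (rule bij_betw_byWitness[where f' = "\<lambda>S. S - {a}"])
    show "\<forall>T\<in>{T. T \<subseteq> {1..b} - {a} \<and> card T = m - 1}. insert a T - {a} = T" by auto
    show "\<forall>S\<in>{S \<in> subsets_of_size b m. a \<in> S}. insert a (S - {a}) = S" by auto
    show "insert a ` {T. T \<subseteq> {1..b} - {a} \<and> card T = m - 1} \<subseteq> {S \<in> subsets_of_size b m. a \<in> S}"
    proof safe
      fix T assume T: "T \<subseteq> {1..b} - {a}" "card T = m - 1"
      hence "finite T" using finite_subset by blast
      moreover have "a \<notin> T" using T by auto
      ultimately have "card (insert a T) = m" using T m by simp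
      moreover have "insert a T \<subseteq> {1..b}" using T a by auto
      ultimately show "insert a T \<in> subsets_of_size b m" by (simp add: subsets_of_size_def)
    qed
    show "(\<lambda>S. S - {a}) ` {S \<in> subsets_of_size b m. a \<in> S} \<subseteq> {T. T \<subseteq> {1..b} - {a} \<and> card T = m - 1}"
      by (auto simp: subsets_of_size_def)
  qed
  hence "card {S \<in> subsets_of_size b m. a \<in> S} = card {T. T \<subseteq> {1..b} - {a} \<and> card T = m - 1}"
    by (simp add: bij_betw_same_card)
  also have "\<dots> = (b - 1) choose (m - 1)"
    using n_subsets[of "{1..b} - {a}" "m - 1"] a by simp
  finally show ?thesis .
qed

lemma sum_subset_weights:
  fixes f :: "nat \<Rightarrow> real"
  assumes f: "sum f {1..b} = 1" and m: "m > 0"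
  shows "(\<Sum>S\<in>subsets_of_size b m. sum f S) = real ((b - 1) choose (m - 1))"
proof -
  have "(\<Sum>S\<in>subsets_of_size b m. sum f S) = (\<Sum>S\<in>subsets_of_size b m. \<Sum>a\<in>{a\<in>{1..b}. a \<in> S}. f a)"
    by (intro sum.cong refl) (auto simp: subsets_of_size_def)
  also have "\<dots> = (\<Sum>a\<in>{1..b}. \<Sum>S\<in>{S\<in>subsets_of_size b m. a \<in> S}. f a)"
    by (rule sum.swap_restrict) auto
  also have "\<dots> = (\<Sum>a\<in>{1..b}. real ((b - 1) choose (m - 1)) * f a)"
    using card_subsets_of_size_containing[OF _ m] by (intro sum.cong refl) simp
  finally show ?thesis using f by (simp add: sum_distrib_left[symmetric])
qed

text \<open>The concave function \<open>x (1 - x)\<close> lies below its tangent at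
  \<open>\<mu> = m / b\<close>, the average of \<open>sum f S\<close> over all \<open>S\<close>. The
  bound is the value for uniform \<open>f\<close>.\<close>

lemma sum_subset_variance_le:
  fixes f :: "nat \<Rightarrow> real"
  assumes f: "sum f {1..b} = 1" and m: "m > 0" "m \<le> b"
  shows "(\<Sum>S\<in>subsets_of_size b m. sum f S * (1 - sum f S))
      \<le> real ((b - 1) choose (m - 1)) * ((real b - real m) / real b)"
proof -
  define c where "c = real ((b - 1) choose (m - 1))"
  define \<mu> where "\<mu> = real m / real b"
  have b0: "real b > 0" using m by simp
  have "m * (b choose m) = b * ((b - 1) choose (m - 1))"
    using m binomial_absorption[of "m - 1" b] by simp
  hence "real m * real (b choose m) = real b * c" unfolding c_def by (metis of_nat_mult)
  hence cm: "real (b choose m) * \<mu> = c" using b0 by (simp add: \<mu>_def field_simps)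
  have "(\<Sum>S\<in>subsets_of_size b m. sum f S * (1 - sum f S))
     \<le> (\<Sum>S\<in>subsets_of_size b m. (1 - 2 * \<mu>) * sum f S + \<mu>\<^sup>2)"
  proof (rule sum_mono)
    fix S
    have "0 \<le> (sum f S - \<mu>)\<^sup>2" by simp
    thus "sum f S * (1 - sum f S) \<le> (1 - 2 * \<mu>) * sum f S + \<mu>\<^sup>2"
      by (simp add: power2_eq_square algebra_simps)
  qed
  also have "\<dots> = (1 - 2 * \<mu>) * c + real (b choose m) * \<mu>\<^sup>2"
    using sum_subset_weights[OF f m(1)]
    by (simp add: sum.distrib sum_distrib_left[symmetric] card_subsets_of_size c_def)
  also have "real (b choose m) * \<mu>\<^sup>2 = c * \<mu>" using cm by (simp add: power2_eq_square)
  finally have "(\<Sum>S\<in>subsets_of_size b m. sum f S * (1 - sum f S)) \<le> c * (1 - \<mu>)"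
    by (simp add: algebra_simps)
  also have "1 - \<mu> = (real b - real m) / real b" using b0 by (simp add: \<mu>_def field_simps)
  finally show ?thesis by (simp add: c_def)
qed

section \<open>Boxes and the cells they cut out of a code\<close>

definition boxes :: "nat \<Rightarrow> nat \<Rightarrow> nat \<Rightarrow> (nat \<Rightarrow> nat set) set" where
  "boxes b m l = PiE {..<l} (\<lambda>_. subsets_of_size b m)"

definition in_box :: "nat \<Rightarrow> nat list \<Rightarrow> (nat \<Rightarrow> nat set) \<Rightarrow> bool" where
  "in_box l x B \<longleftrightarrow> (\<forall>i<l. x ! i \<in> B i)"

lemma finite_boxes [simp]: "finite (boxes b m l)"
  unfolding boxes_def by (intro finite_PiE) auto

lemma card_boxes: "card (boxes b m l) = (b choose m) ^ l"
  unfolding boxes_def by (simp add: card_PiE card_subsets_of_size)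

lemma boxes_containing:
  "{B \<in> boxes b m l. in_box l x B} = PiE {..<l} (\<lambda>i. {S \<in> subsets_of_size b m. x ! i \<in> S})"
  by (auto simp: boxes_def in_box_def PiE_def Pi_def)

lemma card_boxes_containing:
  assumes "\<And>i. i < l \<Longrightarrow> x ! i \<in> {1..b}" "m > 0"
  shows "card {B \<in> boxes b m l. in_box l x B} = ((b - 1) choose (m - 1)) ^ l"
  unfolding boxes_containing using card_subsets_of_size_containing[OF assms(1) assms(2)]
  by (simp add: card_PiE)

text \<open>The sum over a product set factorizes: coordinate \<open>i\<close> carries
  \<open>g\<close>, and each of the other \<open>l - 1\<close> coordinates contributes its number of
  admissible sets.\<close>

lemma sum_boxes_containing:
  fixes g :: "nat set \<Rightarrow> real"
  assumes x: "\<And>i. i < l \<Longrightarrow> x ! i \<in> {1..b}" and m: "m > 0" and i: "i < l"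
  shows "(\<Sum>B | B \<in> boxes b m l \<and> in_box l x B. g (B i))
     = real ((b - 1) choose (m - 1)) ^ (l - 1) * (\<Sum>S | S \<in> subsets_of_size b m \<and> x ! i \<in> S. g S)"
proof -
  define A where "A j = {S \<in> subsets_of_size b m. x ! j \<in> S}" for j
  have cA: "real (card (A j)) = real ((b - 1) choose (m - 1))" if "j < l" for j
    using card_subsets_of_size_containing[OF x[OF that] m] by (simp add: A_def)
  define G where "G j S = (if j = i then g S else 1)" for j S
  have "(\<Sum>B | B \<in> boxes b m l \<and> in_box l x B. g (B i)) = (\<Sum>B\<in>PiE {..<l} A. \<Prod>j<l. G j (B j))"
  proof (rule sum.cong)
    show "{B. B \<in> boxes b m l \<and> in_box l x B} = PiE {..<l} A"
      using boxes_containing[of b m l x] unfolding A_def .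
    fix B
    show "g (B i) = (\<Prod>j<l. G j (B j))"
      using i by (simp add: G_def prod.delta)
  qed
  also have "\<dots> = (\<Prod>j<l. \<Sum>S\<in>A j. G j S)"
    by (rule prod_sum_PiE[symmetric]) (auto simp: A_def)
  also have "\<dots> = (\<Sum>S\<in>A i. g S) * (\<Prod>j\<in>{..<l} - {i}. \<Sum>S\<in>A j. G j S)"
    using i by (subst prod.remove[of _ i]) (auto simp: G_def)
  also have "(\<Prod>j\<in>{..<l} - {i}. \<Sum>S\<in>A j. G j S) = (\<Prod>j\<in>{..<l} - {i}. real ((b - 1) choose (m - 1)))"
    using cA by (intro prod.cong refl) (auto simp: G_def)
  also have "\<dots> = real ((b - 1) choose (m - 1)) ^ (l - 1)" using i by simp
  finally show ?thesis by (simp add: A_def mult.commute)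
qed

lemma finite_words: "finite (words b n)"
proof -
  have "words b n = {w. set w \<subseteq> {1..b} \<and> length w = n}" by (auto simp: words_def)
  thus ?thesis by (simp add: finite_lists_length_eq)
qed

lemma words_nth: "x \<in> words b n \<Longrightarrow> i < n \<Longrightarrow> x ! i \<in> {1..b}"
  unfolding words_def using nth_mem by blast

definition cell :: "nat \<Rightarrow> nat list set \<Rightarrow> (nat \<Rightarrow> nat set) \<Rightarrow> nat list set" where
  "cell l C B = {x\<in>C. in_box l x B}"

context
  fixes b m n l :: nat and C :: "nat list set"
  assumes Cw: "C \<subseteq> words b n" and Cne: "C \<noteq> {}" and m: "2 \<le> m" "m < b" and ln: "l \<le> n"
begin

text \<open>This counts the choices in one prefix coordinate; a word of \<open>C\<close> lies in
  \<open>cells_per_word ^ l\<close> boxes.\<close>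

abbreviation "cells_per_word \<equiv> real ((b - 1) choose (m - 1))"

lemma finite_code: "finite C"
  using Cw finite_words finite_subset by blast

lemma cell_subset: "cell l C B \<subseteq> C" "finite (cell l C B)"
  using finite_code by (auto simp: cell_def)

lemma cell_nth: "x \<in> cell l C B \<Longrightarrow> i < n \<Longrightarrow> x ! i \<in> {1..b}"
  using Cw words_nth by (auto simp: cell_def)

text \<open>All words lie in equally many boxes. Hence a box weighted by the size of its cell,
  followed by a uniform word of that cell, gives a uniform word of the code.\<close>

lemma sum_over_cells:
  fixes h :: "nat list \<Rightarrow> real"
  shows "(\<Sum>B\<in>boxes b m l. \<Sum>x\<in>cell l C B. h x) = cells_per_word ^ l * sum h C"
proof -
  have "(\<Sum>B\<in>boxes b m l. \<Sum>x\<in>cell l C B. h x) = (\<Sum>x\<in>C. \<Sum>B | B \<in> boxes b m l \<and> in_box l x B. h x)"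
    unfolding cell_def using finite_code by (intro sum.swap_restrict) auto
  also have "\<dots> = (\<Sum>x\<in>C. cells_per_word ^ l * h x)"
  proof (intro sum.cong refl)
    fix x assume x: "x \<in> C"
    have "card {B \<in> boxes b m l. in_box l x B} = ((b - 1) choose (m - 1)) ^ l"
      using Cw x ln m words_nth by (intro card_boxes_containing) fastforce+
    thus "(\<Sum>B | B \<in> boxes b m l \<and> in_box l x B. h x) = cells_per_word ^ l * h x" by simp
  qed
  finally show ?thesis by (simp add: sum_distrib_left)
qed

lemma sum_card_cells: "(\<Sum>B\<in>boxes b m l. real (card (cell l C B))) = cells_per_word ^ l * real (card C)"
  using sum_over_cells[of "\<lambda>_. 1"] by simp

text \<open>By \<open>sum_over_cells\<close> the laws in the cells, weighted by cell size, average
  to the law in the code, which is the mean condition of \<open>average_mixed_sum_le\<close>. The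
  bound holds at every coordinate.\<close>

lemma suffix_coordinate_le:
  assumes i: "i < n" and t: "t > 0" and s: "s \<ge> chord_slope ((real b / (real b - 1))\<^sup>2) m"
    and adm: "admissible b s t" "admissible b 1 t"
  shows "(\<Sum>B\<in>boxes b m l. real (card (cell l C B)) * mixed_sum (symbol_freq (cell l C B) i) (symbol_freq C i) m {1..b})
     \<le> uniform_prob b m * (cells_per_word ^ l * real (card C))"
  unfolding sum_card_cells[symmetric]
proof (rule average_mixed_sum_le[where C = s and t = t])
  show "sum (symbol_freq C i) {1..b} = 1"
    using finite_code Cne Cw words_nth i by (intro sum_symbol_freq) auto
  show "sum (symbol_freq (cell l C B) i) {1..b} = 1" if "B \<in> boxes b m l" "real (card (cell l C B)) \<noteq> 0" for B
    using that cell_subset(2)[of B] cell_nth[OF _ i] by (intro sum_symbol_freq) auto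
  fix a assume a: "a \<in> {1..b}"
  have cnt: "real (card {x\<in>D. x ! i = a}) = (\<Sum>x\<in>D. of_bool (x ! i = a))" if "finite D" for D
    using that by (simp add: of_bool_def sum.If_cases Int_def)
  have "(\<Sum>B\<in>boxes b m l. real (card (cell l C B)) * symbol_freq (cell l C B) i a)
      = (\<Sum>B\<in>boxes b m l. \<Sum>x\<in>cell l C B. of_bool (x ! i = a))"
  proof (intro sum.cong refl)
    fix B
    show "real (card (cell l C B)) * symbol_freq (cell l C B) i a = (\<Sum>x\<in>cell l C B. of_bool (x ! i = a))"
      using cnt[of "cell l C B"] cell_subset(2)[of B] by (cases "cell l C B = {}") (auto simp: symbol_freq_def)
  qed
  also have "\<dots> = cells_per_word ^ l * (\<Sum>x\<in>C. of_bool (x ! i = a))" by (rule sum_over_cells)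
  also have "(\<Sum>x\<in>C. of_bool (x ! i = a)) = real (card C) * symbol_freq C i a"
    using cnt[OF finite_code] Cne finite_code by (simp add: symbol_freq_def)
  finally show "(\<Sum>B\<in>boxes b m l. real (card (cell l C B)) * symbol_freq (cell l C B) i a)
      = (\<Sum>B\<in>boxes b m l. real (card (cell l C B))) * symbol_freq C i a"
    by (simp add: sum_card_cells)
qed (use m t s adm in \<open>auto simp: symbol_freq_nonneg\<close>)

text \<open>At a prefix coordinate the law in a cell is supported on the \<open>m\<close>-element
  set \<open>B i\<close>, so \<open>mixed_sum_supported_le\<close> applies. Exchanging the sums over
  words and boxes leaves the sum of \<open>sum f S * (1 - sum f S)\<close> over all
  \<open>S\<close>.\<close>

lemma prefix_coordinate_le:
  assumes i: "i < l"
  shows "(\<Sum>B\<in>boxes b m l. real (card (cell l C B)) * mixed_sum (symbol_freq (cell l C B) i) (symbol_freq C i) m {1..b})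
     \<le> fact m / real m ^ m * ((real b - real m) / real b) * (cells_per_word ^ l * real (card C))"
proof -
  define f where "f = symbol_freq C i"
  define \<kappa> :: real where "\<kappa> = fact m / real m ^ m"
  have \<kappa>0: "\<kappa> \<ge> 0" by (simp add: \<kappa>_def)
  have i': "i < n" using i ln by simp
  have f1: "sum f {1..b} = 1"
    unfolding f_def using finite_code Cne Cw words_nth i' by (intro sum_symbol_freq) auto
  have compl: "sum f ({1..b} - S) = 1 - sum f S" if "S \<in> subsets_of_size b m" for S
    using that f1 by (subst sum_diff) (auto simp: subsets_of_size_def)
  have "(\<Sum>B\<in>boxes b m l. real (card (cell l C B)) * mixed_sum (symbol_freq (cell l C B) i) f m {1..b})
      \<le> (\<Sum>B\<in>boxes b m l. \<Sum>x\<in>cell l C B. \<kappa> * (1 - sum f (B i)))"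
  proof (rule sum_mono)
    fix B assume B: "B \<in> boxes b m l"
    have Bi: "B i \<in> subsets_of_size b m" using B i by (auto simp: boxes_def)
    show "real (card (cell l C B)) * mixed_sum (symbol_freq (cell l C B) i) f m {1..b}
        \<le> (\<Sum>x\<in>cell l C B. \<kappa> * (1 - sum f (B i)))"
    proof (cases "cell l C B = {}")
      case False
      have "mixed_sum (symbol_freq (cell l C B) i) f m {1..b} \<le> \<kappa> * sum f ({1..b} - B i)"
        unfolding \<kappa>_def
      proof (rule mixed_sum_supported_le)
        show "B i \<subseteq> {1..b}" "card (B i) = m" using Bi by (auto simp: subsets_of_size_def)
        show "symbol_freq (cell l C B) i a = 0" if "a \<notin> B i" for a
        proof -
          have "{x\<in>cell l C B. x ! i = a} = {}" using that i by (auto simp: cell_def in_box_def)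
          hence "card {x\<in>cell l C B. x ! i = a} = 0" by (simp only: card.empty)
          thus ?thesis by (simp add: symbol_freq_def)
        qed
        show "sum (symbol_freq (cell l C B) i) {1..b} = 1"
          using False cell_subset(2)[of B] cell_nth[OF _ i'] by (intro sum_symbol_freq) auto
      qed (use m in \<open>auto simp: symbol_freq_nonneg f_def\<close>)
      thus ?thesis using compl[OF Bi] by (simp add: mult_left_mono)
    qed simp
  qed
  also have "\<dots> = (\<Sum>x\<in>C. \<Sum>B | B \<in> boxes b m l \<and> in_box l x B. \<kappa> * (1 - sum f (B i)))"
    unfolding cell_def using finite_code by (intro sum.swap_restrict) auto
  also have "\<dots> = (\<Sum>x\<in>C. cells_per_word ^ (l - 1) *
      (\<Sum>S | S \<in> subsets_of_size b m \<and> x ! i \<in> S. \<kappa> * (1 - sum f S)))"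
  proof (intro sum.cong refl)
    fix x assume "x \<in> C"
    thus "(\<Sum>B | B \<in> boxes b m l \<and> in_box l x B. \<kappa> * (1 - sum f (B i))) = cells_per_word ^ (l - 1) *
      (\<Sum>S | S \<in> subsets_of_size b m \<and> x ! i \<in> S. \<kappa> * (1 - sum f S))"
      using sum_boxes_containing[of l x b m i "\<lambda>S. \<kappa> * (1 - sum f S)"] Cw ln m i words_nth by fastforce
  qed
  also have "\<dots> = cells_per_word ^ (l - 1) *
      (\<Sum>S\<in>subsets_of_size b m. \<Sum>x | x \<in> C \<and> x ! i \<in> S. \<kappa> * (1 - sum f S))"
    unfolding sum_distrib_left[symmetric] using finite_code by (subst sum.swap_restrict) auto
  also have "(\<Sum>S\<in>subsets_of_size b m. \<Sum>x | x \<in> C \<and> x ! i \<in> S. \<kappa> * (1 - sum f S))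
      = real (card C) * \<kappa> * (\<Sum>S\<in>subsets_of_size b m. sum f S * (1 - sum f S))"
    unfolding sum_distrib_left
  proof (intro sum.cong refl)
    fix S assume S: "S \<in> subsets_of_size b m"
    have Sf: "finite S" using S finite_subset by (auto simp: subsets_of_size_def)
    have "{x\<in>C. x ! i \<in> S} = (\<Union>a\<in>S. {x\<in>C. x ! i = a})" by auto
    hence "card {x\<in>C. x ! i \<in> S} = (\<Sum>a\<in>S. card {x\<in>C. x ! i = a})"
      using Sf finite_code by (simp only:) (intro card_UN_disjoint, auto)
    hence "real (card {x\<in>C. x ! i \<in> S}) = real (card C) * sum f S"
      using Cne finite_code by (simp add: f_def symbol_freq_def sum_divide_distrib[symmetric])
    thus "(\<Sum>x | x \<in> C \<and> x ! i \<in> S. \<kappa> * (1 - sum f S)) = real (card C) * \<kappa> * (sum f S * (1 - sum f S))"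
      by simp
  qed
  also have "cells_per_word ^ (l - 1) * (real (card C) * \<kappa> * (\<Sum>S\<in>subsets_of_size b m. sum f S * (1 - sum f S)))
     \<le> cells_per_word ^ (l - 1) * (real (card C) * \<kappa> * (cells_per_word * ((real b - real m) / real b)))"
    using f1 m \<kappa>0 by (intro mult_left_mono sum_subset_variance_le) auto
  also have "\<dots> = \<kappa> * ((real b - real m) / real b) * (cells_per_word ^ l * real (card C))"
  proof -
    have "cells_per_word ^ l = cells_per_word ^ (l - 1) * cells_per_word"
      using i by (cases l) auto
    thus ?thesis by simp
  qed
  finally show ?thesis by (simp add: \<kappa>_def f_def)
qed

end

section \<open>Double counting over all cells\<close>

lemma card_distinct_lists_ge:
  assumes "finite D" "m \<le> card D"
  shows "(real (card D) - real m) ^ m \<le> real (card {xs. set xs \<subseteq> D \<and> length xs = m \<and> distinct xs})"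
proof -
  have "{xs. set xs \<subseteq> D \<and> length xs = m \<and> distinct xs} = {xs. length xs = m \<and> distinct xs \<and> set xs \<subseteq> D}"
    by auto
  hence "card {xs. set xs \<subseteq> D \<and> length xs = m \<and> distinct xs} = \<Prod>{card D - m + 1 .. card D}"
    using card_lists_distinct_length_eq[OF assms] by simp
  moreover have "(\<Prod>i\<in>{card D - m + 1 .. card D}. card D - m) \<le> \<Prod>{card D - m + 1 .. card D}"
    by (intro prod_mono) auto
  ultimately have "(card D - m) ^ m \<le> card {xs. set xs \<subseteq> D \<and> length xs = m \<and> distinct xs}"
    using assms by simp
  thus ?thesis using assms by (metis of_nat_diff of_nat_le_iff of_nat_power)
qed

text \<open>\<open>hash_code_hansel\<close> is averaged over all lists of \<open>m\<close> words
  from \<open>D\<close>. Lists with repetitions contribute at least 0, and the factor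
  \<open>(1 - m / K)^m\<close> bounds the share of repetition-free lists from below.\<close>

lemma sum_mixed_sum_ge:
  assumes C: "is_hash_code b k n C" "finite C" and k: "k = m + 2" "m + 2 \<le> b"
    and D: "D \<subseteq> C" and big: "card C > m" and K: "real m < K" "K \<le> real (card D)"
  shows "(1 - real m / K) ^ m * (real (card C - m) * ln (real (card C - m)) / (real (card C) * ln (real (b - m))))
     \<le> (\<Sum>i<n. mixed_sum (symbol_freq D i) (symbol_freq C i) m {1..b})"
proof -
  define H where "H = real (card C - m) * ln (real (card C - m)) / (real (card C) * ln (real (b - m)))"
  have Df: "finite D" using D C finite_subset by blast
  have K0: "K > 0" using K by (meson le_less_trans of_nat_0_le_iff)
  have d0: "real (card D) > 0" using K K0 by linarith
  have Dne: "D \<noteq> {}" using d0 by auto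
  have lnr: "ln (real (b - m)) > 0" using k by (intro ln_gt_zero) auto
  have H0: "H \<ge> 0" unfolding H_def using lnr big by (intro divide_nonneg_nonneg mult_nonneg_nonneg) auto
  have mD: "m \<le> card D" using K by simp
  define X where "X = {xs. set xs \<subseteq> D \<and> length xs = m}"
  define Y where "Y = {xs. set xs \<subseteq> D \<and> length xs = m \<and> distinct xs}"
  define S where "S xs = (\<Sum>i<n. avoid b (symbol_freq C i) i xs)" for xs
  have Xf: "finite X" unfolding X_def using Df by (rule finite_lists_length_eq)
  have S0: "S xs \<ge> 0" for xs
    unfolding S_def avoid_def by (auto intro!: sum_nonneg symbol_freq_nonneg)
  have SH: "S xs \<ge> H" if "xs \<in> Y" for xs
  proof -
    have "real (card C - m) * ln (real (card C - m)) \<le> ln (real (b - m)) * real (card C) * S xs"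
      unfolding S_def using that D k by (intro hash_code_hansel[OF C k(1) _ _ _ _ big]) (auto simp: Y_def)
    thus ?thesis unfolding H_def using lnr big by (simp add: divide_le_eq mult_ac)
  qed
  have "real (card D) ^ m * (\<Sum>i<n. mixed_sum (symbol_freq D i) (symbol_freq C i) m {1..b}) = (\<Sum>xs\<in>X. S xs)"
    unfolding S_def X_def using sum_lists_avoid_freq[OF Df Dne]
    by (subst sum.swap) (simp add: sum_distrib_left)
  also have "\<dots> \<ge> (\<Sum>xs\<in>Y. S xs)"
    using Xf S0 by (intro sum_mono2) (auto simp: X_def Y_def)
  also have "(\<Sum>xs\<in>Y. S xs) \<ge> (\<Sum>xs\<in>Y. H)" using SH by (intro sum_mono) auto
  also have "(\<Sum>xs\<in>Y. H) = real (card Y) * H" by simp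
  also have "\<dots> \<ge> (real (card D) - real m) ^ m * H"
    using card_distinct_lists_ge[OF Df mD] H0 by (intro mult_right_mono) (auto simp: Y_def)
  also have "(real (card D) - real m) ^ m * H = real (card D) ^ m * ((1 - real m / real (card D)) ^ m * H)"
  proof -
    have "real (card D) - real m = real (card D) * (1 - real m / real (card D))"
      using d0 by (simp add: field_simps)
    thus ?thesis by (simp add: power_mult_distrib)
  qed
  also have "(1 - real m / real (card D)) ^ m * H \<ge> (1 - real m / K) ^ m * H"
  proof (intro mult_right_mono power_mono H0)
    have "real m / real (card D) \<le> real m / K" using K K0 by (intro divide_left_mono) auto
    thus "1 - real m / K \<le> 1 - real m / real (card D)" by simp
    show "0 \<le> 1 - real m / K" using K K0 by simp
  qed
  hence "real (card D) ^ m * ((1 - real m / real (card D)) ^ m * H) \<ge> real (card D) ^ m * ((1 - real m / K) ^ m * H)"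
    by (intro mult_left_mono) auto
  finally show ?thesis
    unfolding H_def[symmetric] by (rule mult_left_le_imp_le) (use d0 in simp)
qed

text \<open>Both sides estimate \<open>T\<close>, the sum over all cells, weighted by size, of the
  contributions of all coordinates. The first \<open>l\<close> coordinates are bounded by
  \<open>prefix_coordinate_le\<close> and the rest by \<open>suffix_coordinate_le\<close>.\<close>

lemma hash_code_finite_bound:
  assumes C: "is_hash_code b k n C" and k: "k = m + 2" "2 \<le> m" "m + 2 \<le> b" and l: "l \<le> n"
    and K: "real m < K" and big: "K\<^sup>2 * (real b / real m) ^ l \<le> real (card C)"
    and t: "t > 0" and s: "s \<ge> chord_slope ((real b / (real b - 1))\<^sup>2) m"
    and adm: "admissible b s t" "admissible b 1 t"
  shows "(1 - real m / K) ^ m * (1 - 1 / K) *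
      (real (card C - m) * ln (real (card C - m)) / (real (card C) * ln (real (b - m))))
    \<le> real (n - l) * uniform_prob b m + real l * (fact m / real m ^ m * ((real b - real m) / real b))"
proof -
  define c where "c = real ((b - 1) choose (m - 1))"
  define M where "M = real (card C)"
  define \<Theta> where "\<Theta> = (1 - real m / K) ^ m *
      (real (card C - m) * ln (real (card C - m)) / (real (card C) * ln (real (b - m))))"
  define G where "G = fact m / real m ^ m * ((real b - real m) / real b)"
  have Cw: "C \<subseteq> words b n" using C by (simp add: is_hash_code_def)
  have Cf: "finite C" using Cw finite_words finite_subset by blast
  have K2: "K > 2" using K k by linarith
  have m0: "real m > 0" using k by simp
  have bm: "real b / real m \<ge> 1" using k by simp
  have "K\<^sup>2 * 1 \<le> K\<^sup>2 * (real b / real m) ^ l" using bm by (intro mult_left_mono one_le_power) auto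
  hence KM: "K\<^sup>2 \<le> M" using big by (simp add: M_def)
  have "K * 1 < K * K" using K2 by (intro mult_strict_left_mono) auto
  hence mM: "real m < M" using KM K unfolding power2_eq_square by linarith
  hence mC: "m < card C" and M0: "M > 0" by (auto simp: M_def)
  have Cne: "C \<noteq> {}" using mC by auto
  have c0: "c > 0" using k by (auto simp: c_def)
  have mb: "m < b" using k by simp
  define \<psi> where "\<psi> B i = mixed_sum (symbol_freq (cell l C B) i) (symbol_freq C i) m {1..b}" for B i
  define T where "T = (\<Sum>B\<in>boxes b m l. real (card (cell l C B)) * (\<Sum>i<n. \<psi> B i))"
  have tot: "(\<Sum>B\<in>boxes b m l. real (card (cell l C B))) = c ^ l * M"
    using sum_card_cells[OF Cw Cne k(2) mb l] unfolding c_def M_def .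
  have \<psi>0: "\<psi> B i \<ge> 0" for B i
    unfolding \<psi>_def by (intro mixed_sum_nonneg symbol_freq_nonneg)
  have lnr: "ln (real (b - m)) > 0" using k by (intro ln_gt_zero) auto
  have \<Theta>0: "\<Theta> \<ge> 0" unfolding \<Theta>_def using K K2 mC lnr by auto
  have "T = (\<Sum>i<n. \<Sum>B\<in>boxes b m l. real (card (cell l C B)) * \<psi> B i)"
    unfolding T_def sum_distrib_left by (rule sum.swap)
  also have "\<dots> = (\<Sum>i<l. \<Sum>B\<in>boxes b m l. real (card (cell l C B)) * \<psi> B i)
      + (\<Sum>i=l..<n. \<Sum>B\<in>boxes b m l. real (card (cell l C B)) * \<psi> B i)"
    using l by (simp add: lessThan_atLeast0 sum.atLeastLessThan_concat)
  also have "\<dots> \<le> (\<Sum>i<l. G * (c ^ l * M)) + (\<Sum>i=l..<n. uniform_prob b m * (c ^ l * M))"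
  proof (intro add_mono sum_mono)
    fix i assume "i \<in> {..<l}"
    thus "(\<Sum>B\<in>boxes b m l. real (card (cell l C B)) * \<psi> B i) \<le> G * (c ^ l * M)"
      using prefix_coordinate_le[OF Cw Cne k(2) mb l, of i] unfolding c_def M_def G_def \<psi>_def by simp
  next
    fix i assume "i \<in> {l..<n}"
    thus "(\<Sum>B\<in>boxes b m l. real (card (cell l C B)) * \<psi> B i) \<le> uniform_prob b m * (c ^ l * M)"
      using suffix_coordinate_le[OF Cw Cne k(2) mb l _ t s adm, of i] unfolding c_def M_def \<psi>_def by simp
  qed
  also have "\<dots> = (real (n - l) * uniform_prob b m + real l * G) * (c ^ l * M)"
    by (simp add: algebra_simps)
  finally have upper: "T \<le> (real (n - l) * uniform_prob b m + real l * G) * (c ^ l * M)" .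
  \<comment> \<open>Subtracting \<open>K\<close> treats all cells alike: cells with fewer than
    \<open>K\<close> words get a negative lower bound, and their true contribution is
    nonnegative.\<close>
  have "(\<Sum>B\<in>boxes b m l. \<Theta> * (real (card (cell l C B)) - K)) \<le> T"
    unfolding T_def
  proof (rule sum_mono)
    fix B assume B: "B \<in> boxes b m l"
    show "\<Theta> * (real (card (cell l C B)) - K) \<le> real (card (cell l C B)) * (\<Sum>i<n. \<psi> B i)"
    proof (cases "K \<le> real (card (cell l C B))")
      case True
      have "\<Theta> \<le> (\<Sum>i<n. \<psi> B i)"
        unfolding \<Theta>_def \<psi>_def
        using True k K mC by (intro sum_mixed_sum_ge[OF C Cf]) (auto simp: cell_def)
      hence "\<Theta> * real (card (cell l C B)) \<le> (\<Sum>i<n. \<psi> B i) * real (card (cell l C B))"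
        by (intro mult_right_mono) auto
      moreover have "\<Theta> * K \<ge> 0" using \<Theta>0 K2 by simp
      ultimately show ?thesis by (simp add: algebra_simps)
    next
      case False
      hence "\<Theta> * (real (card (cell l C B)) - K) \<le> 0" using \<Theta>0 by (intro mult_nonneg_nonpos) auto
      also have "0 \<le> real (card (cell l C B)) * (\<Sum>i<n. \<psi> B i)" using \<psi>0 by (simp add: sum_nonneg)
      finally show ?thesis .
    qed
  qed
  also have "(\<Sum>B\<in>boxes b m l. \<Theta> * (real (card (cell l C B)) - K)) = \<Theta> * (c ^ l * M - K * real (b choose m) ^ l)"
    using tot by (simp add: sum_distrib_left[symmetric] sum_subtractf card_boxes)
  finally have lower: "\<Theta> * (c ^ l * M - K * real (b choose m) ^ l) \<le> T" .
  have "m * (b choose m) = b * ((b - 1) choose (m - 1))"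
    using k binomial_absorption[of "m - 1" b] by simp
  hence "real m * real (b choose m) = real b * c" unfolding c_def by (metis of_nat_mult)
  hence "real (b choose m) = c * (real b / real m)" using m0 by (simp add: field_simps)
  hence bl: "real (b choose m) ^ l = c ^ l * (real b / real m) ^ l" by (simp only: power_mult_distrib)
  \<comment> \<open>Of the factor \<open>K^2\<close> in \<open>big\<close>, one \<open>K\<close>
    pays for the size threshold and the other makes the total loss a fraction
    \<open>1 / K\<close>.\<close>
  have "K * (real b / real m) ^ l = (K\<^sup>2 * (real b / real m) ^ l) / K"
    using K2 by (simp add: power2_eq_square)
  also have "\<dots> \<le> M / K" using big K2 by (intro divide_right_mono) (auto simp: M_def)
  finally have "c ^ l * (K * (real b / real m) ^ l) \<le> c ^ l * (M / K)"
    using c0 by (intro mult_left_mono) auto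
  hence "c ^ l * M - K * real (b choose m) ^ l \<ge> (1 - 1 / K) * (c ^ l * M)"
    unfolding bl by (simp add: algebra_simps)
  hence "\<Theta> * ((1 - 1 / K) * (c ^ l * M)) \<le> \<Theta> * (c ^ l * M - K * real (b choose m) ^ l)"
    using \<Theta>0 by (intro mult_left_mono)
  hence "(\<Theta> * (1 - 1 / K)) * (c ^ l * M) \<le> (real (n - l) * uniform_prob b m + real l * G) * (c ^ l * M)"
    using lower upper by (simp add: mult.assoc)
  hence "\<Theta> * (1 - 1 / K) \<le> real (n - l) * uniform_prob b m + real l * G"
    using c0 M0 by (simp add: mult_le_cancel_right)
  thus ?thesis by (simp add: \<Theta>_def G_def mult_ac)
qed

section \<open>From codes to rates\<close>

text \<open>The maximum is over a finite set, nonempty because the empty code qualifies when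
  \<open>k > 0\<close>.\<close>

lemma A_hash_attained:
  assumes "k > 0"
  obtains C where "is_hash_code b k n C" "card C = A_hash b k n"
proof -
  have "{C. is_hash_code b k n C} \<subseteq> Pow (words b n)" by (auto simp: is_hash_code_def)
  hence fin: "finite (card ` {C. is_hash_code b k n C})"
    using finite_words finite_subset by blast
  have "is_hash_code b k n {}" using assms by (auto simp: is_hash_code_def)
  hence "card ` {C. is_hash_code b k n C} \<noteq> {}" by blast
  from Max_in[OF fin this] have "A_hash b k n \<in> card ` {C. is_hash_code b k n C}"
    by (simp add: A_hash_def)
  thus ?thesis using that by auto
qed

lemma R_hash_le:
  assumes "k > 0" "\<tau> > 0"
    and ev: "eventually (\<lambda>n. \<forall>C. is_hash_code b k n C \<longrightarrow> real (card C) < 2 powr (\<tau> * real n)) sequentially"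
  shows "R_hash b k \<le> ereal \<tau>"
  unfolding R_hash_def
proof (rule Limsup_bounded)
  show "eventually (\<lambda>n. ereal (log 2 (real (A_hash b k n)) / real n) \<le> ereal \<tau>) sequentially"
    using ev eventually_gt_at_top[of 0]
  proof eventually_elim
    case (elim n)
    obtain C where C: "is_hash_code b k n C" "card C = A_hash b k n"
      using A_hash_attained[OF assms(1)] by blast
    have lt: "real (A_hash b k n) < 2 powr (\<tau> * real n)" using elim C by metis
    have "log 2 (real (A_hash b k n)) \<le> \<tau> * real n"
    proof (cases "A_hash b k n = 0")
      case True
      \<comment> \<open>Here \<open>log 2 0 = 0\<close> by convention.\<close>
      thus ?thesis using assms(2) by (simp add: log_def)
    next
      case False
      hence "log 2 (real (A_hash b k n)) \<le> log 2 (2 powr (\<tau> * real n))"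
        using lt by (subst log_le_cancel_iff) auto
      thus ?thesis by simp
    qed
    thus ?case using elim(2) by (simp add: divide_le_eq)
  qed
qed

text \<open>The prefix has length \<open>floor (\<nu> n)\<close>. By \<open>\<tau>1\<close>,
  \<open>(b / m)^l\<close> is exponentially smaller than a code of size \<open>2^(\<tau> n)\<close>,
  so \<open>hash_code_finite_bound\<close> applies; after division by \<open>n\<close> it
  contradicts \<open>\<tau>2\<close> for large \<open>n\<close>.\<close>

lemma R_hash_le_of_prefix_fraction:
  fixes b m :: nat and t s \<nu> \<tau> :: real
  assumes m: "2 \<le> m" "m + 2 \<le> b"
    and t: "t > 0" and s: "s \<ge> chord_slope ((real b / (real b - 1))\<^sup>2) m"
    and adm: "admissible b s t" "admissible b 1 t"
    and \<nu>: "0 \<le> \<nu>" "\<nu> \<le> 1" and \<tau>0: "\<tau> > 0"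
    and \<tau>1: "\<tau> > \<nu> * log 2 (real b / real m)"
    and \<tau>2: "\<tau> > log 2 (real (b - m)) *
      ((1 - \<nu>) * uniform_prob b m + \<nu> * (fact m / real m ^ m * ((real b - real m) / real b)))"
  shows "R_hash b (m + 2) \<le> ereal \<tau>"
proof (rule R_hash_le)
  define F where "F = uniform_prob b m"
  define G where "G = fact m / real m ^ m * ((real b - real m) / real b)"
  define L where "L = log 2 (real (b - m))"
  define \<rho> where "\<rho> = L * ((1 - \<nu>) * F + \<nu> * G)"
  define \<delta> where "\<delta> = \<tau> - \<nu> * log 2 (real b / real m)"
  have \<delta>0: "\<delta> > 0" using \<tau>1 by (simp add: \<delta>_def)
  have L0: "L > 0" using m by (simp add: L_def)
  have F0: "F \<ge> 0" by (simp add: F_def uniform_prob_def)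
  have G0: "G \<ge> 0" using m by (simp add: G_def)
  have "\<rho> < \<tau>" using \<tau>2 by (simp add: \<rho>_def L_def F_def G_def)
  \<comment> \<open>\<open>K\<close> is fixed before \<open>n\<close> grows, large enough that its
    losses fit into the gap between \<open>\<rho>\<close> and \<open>\<tau>\<close>.\<close>
  have "((\<lambda>K. (1 - real m / K) ^ m * (1 - 1 / K) * \<tau>) \<longlongrightarrow> (1 - 0) ^ m * (1 - 0) * \<tau>) at_top"
    by (intro tendsto_intros real_tendsto_divide_at_top[OF tendsto_const filterlim_ident])
  hence "eventually (\<lambda>K. (1 - real m / K) ^ m * (1 - 1 / K) * \<tau> > \<rho>) at_top"
    using \<open>\<rho> < \<tau>\<close> by (intro order_tendstoD) auto
  hence "eventually (\<lambda>K. real m < K \<and> (1 - real m / K) ^ m * (1 - 1 / K) * \<tau> > \<rho>) at_top"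
    using eventually_gt_at_top[of "real m"] by eventually_elim auto
  then obtain K where K: "real m < K" "(1 - real m / K) ^ m * (1 - 1 / K) * \<tau> > \<rho>"
    using eventually_happens[of _ at_top] by (metis (mono_tags, lifting) trivial_limit_at_top_linorder)
  define \<theta> where "\<theta> = (1 - real m / K) ^ m * (1 - 1 / K)"
  have K1: "K > 1" using K m by linarith
  have \<theta>0: "\<theta> \<ge> 0" using K K1 by (simp add: \<theta>_def)
  define x where "x = 2 powr \<tau>"
  \<comment> \<open>\<open>y^n\<close> is the surplus of the code size over the number of boxes a
    code must fill: \<open>(b / m)^l <= x^n / y^n\<close>. For large \<open>n\<close> it absorbs
    \<open>K^2\<close>.\<close>
  define y where "y = 2 powr \<delta>"
  have x1: "x > 1" and y1: "y > 1" using \<tau>0 \<delta>0 by (auto simp: x_def y_def)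
  have lim0: "(\<lambda>n. real m / x ^ n) \<longlonglongrightarrow> 0" "(\<lambda>n. K\<^sup>2 / y ^ n) \<longlonglongrightarrow> 0"
    using x1 y1 by (auto intro: LIMSEQ_divide_realpow_zero)
  have i0: "(\<lambda>n. 1 / real n) \<longlonglongrightarrow> 0" by (rule lim_1_over_n)
  have "(\<lambda>n. \<theta> * (1 - real m / x ^ n) * (\<tau> - 1 / real n) - (\<rho> + L * F * (1 / real n)))
      \<longlonglongrightarrow> \<theta> * (1 - 0) * (\<tau> - 0) - (\<rho> + L * F * 0)"
    by (intro tendsto_intros lim0 i0)
  hence ev1: "eventually (\<lambda>n. \<theta> * (1 - real m / x ^ n) * (\<tau> - 1 / real n) - (\<rho> + L * F * (1 / real n)) > 0) sequentially"
    using K by (intro order_tendstoD) (auto simp: \<theta>_def)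
  have ev2: "eventually (\<lambda>n. K\<^sup>2 / y ^ n < 1) sequentially"
    using lim0(2) by (intro order_tendstoD) auto
  have ev3: "eventually (\<lambda>n. real m / x ^ n < 1 / 2) sequentially"
    using lim0(1) by (intro order_tendstoD) auto
  show "eventually (\<lambda>n. \<forall>C. is_hash_code b (m + 2) n C \<longrightarrow> real (card C) < 2 powr (\<tau> * real n)) sequentially"
    using ev1 ev2 ev3 eventually_gt_at_top[of 0] eventually_ge_at_top[of "nat \<lceil>1 / \<tau>\<rceil>"]
  proof eventually_elim
    case (elim n)
    show ?case
    proof (intro allI impI, rule ccontr)
      fix C assume C: "is_hash_code b (m + 2) n C" and "\<not> real (card C) < 2 powr (\<tau> * real n)"
      moreover have xn: "2 powr (\<tau> * real n) = x ^ n"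
        by (simp add: x_def powr_powr[symmetric] powr_realpow)
      ultimately have M: "x ^ n \<le> real (card C)" by simp
      define M where "M = real (card C)"
      have xn0: "x ^ n > 0" using x1 by simp
      have M0: "M > 0" using M xn0 by (simp add: M_def)
      define l where "l = nat \<lfloor>\<nu> * real n\<rfloor>"
      have l1: "real l \<le> \<nu> * real n" "\<nu> * real n < real l + 1"
        using \<nu> by (auto simp: l_def)
      have "\<nu> * real n \<le> 1 * real n" using \<nu> by (intro mult_right_mono) auto
      hence ln: "l \<le> n" using l1 by linarith
      have bm: "real b / real m > 1" using m by simp
      have "(real b / real m) ^ l = (real b / real m) powr real l" using bm by (simp add: powr_realpow)
      also have "\<dots> \<le> (real b / real m) powr (\<nu> * real n)" using l1 bm by (intro powr_mono) auto
      also have "\<dots> = 2 powr (log 2 (real b / real m) * (\<nu> * real n))"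
        using bm by (simp add: powr_powr[symmetric])
      also have "\<dots> = x ^ n / y ^ n"
        by (simp add: xn[symmetric] y_def \<delta>_def powr_realpow[symmetric] powr_powr powr_diff[symmetric] algebra_simps)
      finally have "K\<^sup>2 * (real b / real m) ^ l \<le> K\<^sup>2 * (x ^ n / y ^ n)" by (intro mult_left_mono) auto
      also have "\<dots> = x ^ n * (K\<^sup>2 / y ^ n)" by simp
      also have "\<dots> \<le> x ^ n * 1" using elim(2) xn0 by (intro mult_left_mono) auto
      finally have big: "K\<^sup>2 * (real b / real m) ^ l \<le> real (card C)" using M by simp
      have "\<theta> * (real (card C - m) * ln (real (card C - m)) / (real (card C) * ln (real (b - m))))
         \<le> real (n - l) * F + real l * G"
        unfolding \<theta>_def F_def G_def
        by (rule hash_code_finite_bound[OF C refl m ln K(1) big t s adm])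
      also have "\<dots> \<le> ((1 - \<nu>) * real n + 1) * F + (\<nu> * real n) * G"
        using l1 ln F0 G0 by (intro add_mono mult_right_mono) (auto simp: of_nat_diff algebra_simps)
      finally have up: "\<theta> * (real (card C - m) * ln (real (card C - m)) / (M * ln (real (b - m))))
         \<le> ((1 - \<nu>) * real n + 1) * F + (\<nu> * real n) * G" by (simp add: M_def)
      have mM: "real m / M \<le> real m / x ^ n" using M xn0 by (intro divide_left_mono) (auto simp: M_def)
      hence half: "real m / M < 1 / 2" using elim(3) by linarith
      hence mM2: "real m < M / 2" using M0 by (simp add: field_simps)
      hence mC: "m < card C" by (simp add: M_def)
      have sub: "real (card C - m) = M - real m" using mC by (simp add: M_def of_nat_diff)
      have "x ^ n / 2 \<le> M - real m" using M mM2 by (simp add: M_def)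
      hence "ln (x ^ n / 2) \<le> ln (M - real m)" using xn0 mM2 M0 by (subst ln_le_cancel_iff) auto
      moreover have "ln (x ^ n / 2) = (\<tau> * real n - 1) * ln 2"
        using xn0 by (simp add: ln_div xn[symmetric] ln_powr algebra_simps)
      ultimately have lnM: "(\<tau> * real n - 1) * ln 2 \<le> ln (M - real m)" by simp
      \<comment> \<open>The 1 is the base 2 logarithm of the 2 lost in
        \<open>M - m >= x^n / 2\<close>; \<open>mult_mono\<close> below needs the sign.\<close>
      have tn: "\<tau> * real n - 1 \<ge> 0"
      proof -
        have "1 / \<tau> \<le> real n" using elim(5) by linarith
        thus ?thesis using \<tau>0 by (simp add: field_simps)
      qed
      have frac: "1 - real m / x ^ n \<le> (M - real m) / M" using mM M0 by (simp add: diff_divide_distrib)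
      have lnr: "ln (real (b - m)) = L * ln 2" by (simp add: L_def log_def)
      have "(1 - real m / x ^ n) * ((\<tau> * real n - 1) * ln 2) \<le> (M - real m) / M * ln (M - real m)"
        using frac lnM tn elim(3) by (intro mult_mono) (auto intro!: divide_nonneg_pos simp: M0 mM2 less_imp_le)
      hence "(1 - real m / x ^ n) * ((\<tau> * real n - 1) * ln 2) / (L * ln 2)
           \<le> (M - real m) / M * ln (M - real m) / (L * ln 2)"
        using L0 by (intro divide_right_mono) auto
      hence "(1 - real m / x ^ n) * (\<tau> * real n - 1) / L \<le> (M - real m) * ln (M - real m) / (M * ln (real (b - m)))"
        using L0 by (simp add: lnr)
      hence "\<theta> * ((1 - real m / x ^ n) * (\<tau> * real n - 1) / L) \<le> ((1 - \<nu>) * real n + 1) * F + (\<nu> * real n) * G"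
        using up \<theta>0 unfolding sub by (meson mult_left_mono order_trans)
      hence "\<theta> * (1 - real m / x ^ n) * (\<tau> * real n - 1) \<le> L * (((1 - \<nu>) * real n + 1) * F + (\<nu> * real n) * G)"
        using L0 by (simp add: field_simps)
      also have "\<dots> = real n * (\<rho> + L * F * (1 / real n))" using elim(4) by (simp add: \<rho>_def field_simps)
      finally have "\<theta> * (1 - real m / x ^ n) * (\<tau> * real n - 1) \<le> real n * (\<rho> + L * F * (1 / real n))" .
      moreover have "\<tau> * real n - 1 = real n * (\<tau> - 1 / real n)" using elim(4) by (simp add: field_simps)
      ultimately have "real n * (\<theta> * (1 - real m / x ^ n) * (\<tau> - 1 / real n)) \<le> real n * (\<rho> + L * F * (1 / real n))"
        by (simp only: mult_ac)
      hence "\<theta> * (1 - real m / x ^ n) * (\<tau> - 1 / real n) \<le> \<rho> + L * F * (1 / real n)"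
        using elim(4) by (simp add: mult_le_cancel_left)
      thus False using elim(1) by linarith
    qed
  qed
qed (use \<tau>0 in auto)

section \<open>The strict inequality and its numerical verification\<close>

lemma uniform_prob_eq_prod:
  assumes "m < b"
  shows "uniform_prob b m = (\<Prod>i<m. real b - 1 - real i) / real b ^ m"
proof -
  have "real (b - 1 choose m) = (\<Prod>i=0..<m. real (b - 1) - real i) / fact m"
    by (simp add: binomial_gbinomial gbinomial_prod_rev)
  also have "real (b - 1) = real b - 1" using assms by simp
  finally show ?thesis by (simp add: uniform_prob_def atLeast0LessThan)
qed

text \<open>With \<open>k - 1 = m + 1\<close>, this turns the quotient of \<open>b^(k-1)\<close> by
  the falling factorial into \<open>1 / uniform_prob b m\<close>.\<close>

lemma prod_falling_eq:
  assumes "m < b"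
  shows "(\<Prod>i<Suc m. real (b - i)) = real b ^ Suc m * uniform_prob b m"
proof -
  have "(\<Prod>i<Suc m. real (b - i)) = real b * (\<Prod>i<m. real (b - Suc i))"
    by (subst prod.lessThan_Suc_shift) simp
  also have "(\<Prod>i<m. real (b - Suc i)) = (\<Prod>i<m. real b - 1 - real i)"
    using assms by (intro prod.cong) (auto simp: of_nat_diff)
  also have "\<dots> = real b ^ m * uniform_prob b m"
    using assms by (simp add: uniform_prob_eq_prod)
  finally show ?thesis by simp
qed

text \<open>At the prefix fraction \<open>T / log\<^sub>2 (b/m)\<close> the first condition on \<open>\<tau>\<close> in
  \<open>R_hash_le_of_prefix_fraction\<close> reads \<open>\<tau> > T\<close>, and the second one has slack by hypothesis \<open>gain\<close>; hence a
  slightly smaller fraction admits some \<open>\<tau> < T\<close>. The hypotheses \<open>small\<close> keep the fraction below \<open>1\<close>.\<close>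
lemma R_hash_less_generic:
  fixes b m g u w :: nat and t s :: real
  assumes m: "2 \<le> m" "m + 2 \<le> b"
    and t: "t > 0" and s: "s \<ge> chord_slope ((real b / (real b - 1))\<^sup>2) m"
    and adm: "admissible b s t" "admissible b 1 t"
    and ratio: "fact m / real m ^ m * ((real b - real m) / real b) * real w \<le> real u * uniform_prob b m"
    and uw: "u < w"
    and gain: "(real b / real m) ^ w < (real b / (real m - 1)) ^ (w - u)"
    and small: "real g * uniform_prob b m \<le> 1" "g > 0" "real (b - m) \<le> (real b / real m) ^ g"
  shows "R_hash b (m + 2) < ereal (1 / (1 / log 2 (real b / (real m - 1)) +
      1 / (uniform_prob b m * log 2 (real (b - m)))))"
proof -
  define F where "F = uniform_prob b m"
  define G where "G = fact m / real m ^ m * ((real b - real m) / real b)"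
  define L where "L = log 2 (real (b - m))"
  define la where "la = log 2 (real b / (real m - 1))"
  define lb where "lb = log 2 (real b / real m)"
  define \<rho> where "\<rho> = real u / real w"
  define T where "T = 1 / (1 / la + 1 / (F * L))"
  have F0: "F > 0" using m by (simp add: F_def uniform_prob_def)
  have L0: "L > 0" using m by (simp add: L_def)
  have la0: "la > 0" and lb0: "lb > 0" using m by (auto simp: la_def lb_def)
  have w0: "real w > 0" using uw by simp
  have \<rho>1: "\<rho> < 1" using uw by (simp add: \<rho>_def)
  have G\<rho>: "G \<le> \<rho> * F" using ratio w0 by (simp add: G_def F_def \<rho>_def field_simps)
  \<comment> \<open>The logarithm of \<open>gain\<close>, which is stated with integer powers so
    that instances reduce to rational arithmetic.\<close>
  have gain': "lb < (1 - \<rho>) * la"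
  proof -
    have "real w * lb = log 2 ((real b / real m) ^ w)" using m by (simp add: lb_def log_nat_power)
    also have "\<dots> < log 2 ((real b / (real m - 1)) ^ (w - u))" using gain m by (subst log_less_cancel_iff) auto
    also have "\<dots> = real (w - u) * la" using m by (simp add: la_def log_nat_power)
    also have "real (w - u) = real w * (1 - \<rho>)" using uw w0 by (simp add: \<rho>_def of_nat_diff field_simps)
    finally show ?thesis using w0 by (simp add: mult.assoc)
  qed
  \<comment> \<open>Together with \<open>T < P\<close> this gives \<open>T < lb\<close>, so a
    fraction below \<open>T / lb\<close> is at most 1.\<close>
  have FL: "F * L \<le> lb"
  proof -
    have "L \<le> log 2 ((real b / real m) ^ g)" unfolding L_def using small m by (subst log_le_cancel_iff) auto
    also have "\<dots> = real g * lb" using m by (simp add: lb_def log_nat_power)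
    finally have "F * L \<le> F * (real g * lb)" using F0 by (intro mult_left_mono) auto
    also have "\<dots> = (real g * F) * lb" by simp
    also have "\<dots> \<le> 1 * lb" using small lb0 by (intro mult_right_mono) (auto simp: F_def)
    finally show ?thesis by simp
  qed
  define P where "P = F * L"
  have P0: "P > 0" using F0 L0 by (simp add: P_def)
  have T_eq: "T = P * la / (P + la)" using P0 la0 by (simp add: T_def P_def[symmetric] field_simps)
  have T0: "T > 0" using P0 la0 by (simp add: T_eq)
  have TP: "T < P" using P0 la0 by (simp add: T_eq field_simps)
  have PT: "(P - T) * la = P * T" using P0 la0 by (simp add: T_eq field_simps)
  define D where "D = P * (1 - \<rho>)"
  have D0: "D > 0" using P0 \<rho>1 by (simp add: D_def)
  \<comment> \<open>The first condition asks for \<open>\<nu> < T / lb\<close>, the second, in the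
    form \<open>P - \<nu> D < T\<close>, for \<open>\<nu> > (P - T) / D\<close>. The identity
    \<open>(P - T) la = P T\<close> and \<open>gain'\<close> leave room between these
    bounds.\<close>
  have less: "(P - T) / D < T / lb"
  proof -
    have "(P - T) * lb < (P - T) * ((1 - \<rho>) * la)" using gain' TP by (intro mult_strict_left_mono) auto
    also have "\<dots> = (1 - \<rho>) * (P * T)" using PT by (simp add: mult_ac)
    finally have "(P - T) * lb < T * D" by (simp add: D_def mult_ac)
    thus ?thesis using D0 lb0 by (simp add: field_simps)
  qed
  obtain \<nu> where \<nu>1: "(P - T) / D < \<nu>" "\<nu> < T / lb" using dense[OF less] by blast
  have \<nu>0: "\<nu> \<ge> 0" using \<nu>1 TP D0 by (meson diff_ge_0_iff_ge divide_nonneg_pos less_imp_le order_trans)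
  have "T / lb \<le> 1" using TP FL lb0 by (simp add: P_def)
  hence \<nu>le: "\<nu> \<le> 1" using \<nu>1 by linarith
  have b1: "\<nu> * lb < T" using \<nu>1 lb0 by (simp add: field_simps)
  have b2: "L * ((1 - \<nu>) * F + \<nu> * G) < T"
  proof -
    have "L * ((1 - \<nu>) * F + \<nu> * G) \<le> L * ((1 - \<nu>) * F + \<nu> * (\<rho> * F))"
      using L0 G\<rho> \<nu>0 by (intro mult_left_mono add_left_mono) auto
    also have "\<dots> = P - \<nu> * D" by (simp add: P_def D_def algebra_simps)
    also have "\<dots> < T" using \<nu>1(1) D0 by (simp add: field_simps)
    finally show ?thesis .
  qed
  obtain \<tau> where \<tau>: "\<nu> * lb < \<tau>" "L * ((1 - \<nu>) * F + \<nu> * G) < \<tau>" "0 < \<tau>" "\<tau> < T"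
    using dense[of "max (max (\<nu> * lb) (L * ((1 - \<nu>) * F + \<nu> * G))) 0" T] b1 b2 T0 by auto
  have "R_hash b (m + 2) \<le> ereal \<tau>"
    using \<tau> \<nu>0 \<nu>le unfolding F_def G_def L_def lb_def
    by (intro R_hash_le_of_prefix_fraction[OF m t s adm, of \<nu>]) auto
  also have "ereal \<tau> < ereal T" using \<tau> by simp
  finally show ?thesis by (simp add: T_def la_def F_def L_def)
qed

text \<open>\<open>u / w\<close> bounds the ratio of the contributions of a prefix coordinate and of a later one.\<close>
definition certificate :: "nat \<Rightarrow> nat \<Rightarrow> real \<Rightarrow> real \<Rightarrow> nat \<Rightarrow> nat \<Rightarrow> nat \<Rightarrow> bool" where
  "certificate b m s t u w g \<longleftrightarrow> 2 \<le> m \<and> m + 2 \<le> b \<and> t > 0 \<and>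
     s \<ge> chord_slope ((real b / (real b - 1))\<^sup>2) m \<and> admissible b s t \<and> admissible b 1 t \<and>
     fact m / real m ^ m * ((real b - real m) / real b) * real w \<le> real u * uniform_prob b m \<and> u < w \<and>
     (real b / real m) ^ w < (real b / (real m - 1)) ^ (w - u) \<and>
     real g * uniform_prob b m \<le> 1 \<and> g > 0 \<and> real (b - m) \<le> (real b / real m) ^ g"

lemma R_hash_less_if_certificate:
  assumes cert: "certificate b m s t u w g" and k: "k = m + 2"
  shows "R_hash b k < ereal (1 / (1 / log 2 (real b / (real k - 3))
            + real b ^ (k - 1) / ((\<Prod>i<k - 1. real (b - i)) * log 2 (real b - real k + 2))))"
proof -
  have m: "2 \<le> m" "m + 2 \<le> b" using cert by (auto simp: certificate_def)
  have "R_hash b (m + 2) < ereal (1 / (1 / log 2 (real b / (real m - 1)) +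
      1 / (uniform_prob b m * log 2 (real (b - m)))))"
    by (rule R_hash_less_generic[of m b t s w u g]) (use cert in \<open>auto simp: certificate_def\<close>)
  moreover have "real b ^ (k - 1) / ((\<Prod>i<k - 1. real (b - i)) * log 2 (real b - real k + 2))
     = 1 / (uniform_prob b m * log 2 (real (b - m)))"
  proof -
    have "real b - real k + 2 = real (b - m)" using m k by (simp add: of_nat_diff)
    moreover have "k - 1 = Suc m" using k by simp
    moreover have "real b ^ Suc m > 0" using m by simp
    ultimately show ?thesis using m by (simp only: prod_falling_eq) (simp add: divide_simps)
  qed
  moreover have "real k - 3 = real m - 1" using k by simp
  ultimately show ?thesis using k by simp
qed

text \<open>All conditions are rational inequalities. \<open>admissible b 1 t\<close> forces
  \<open>t < 4\<close>, while \<open>admissible b s t\<close> keeps \<open>t\<close> from being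
  small compared with \<open>s\<close>, which in turn must reach the chord slope; hence
  \<open>t\<close> grows for the larger \<open>m\<close>.\<close>

lemma certificates:
  shows "certificate 6 4 3 (5 / 2) 2 5 2"
    "certificate 7 4 3 (5 / 2) 1 3 2"
    "certificate 8 4 3 (5 / 2) 1 4 2"
    "certificate 9 4 3 (5 / 2) 1 4 2"
    "certificate 10 4 3 (5 / 2) 1 5 2"
    "certificate 11 4 3 (5 / 2) 1 5 2"
    "certificate 12 4 3 (5 / 2) 1 5 2"
    "certificate 13 4 3 (5 / 2) 1 6 2"
    "certificate 14 4 3 (5 / 2) 1 6 2"
    "certificate 8 5 (7 / 2) (5 / 2) 1 4 3"
    "certificate 9 5 (7 / 2) (5 / 2) 1 4 3"
    "certificate 10 5 3 (5 / 2) 1 5 3"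
    "certificate 11 5 3 (5 / 2) 1 5 3"
    "certificate 12 5 3 (5 / 2) 1 5 3"
    "certificate 13 5 3 (5 / 2) 1 6 3"
    "certificate 14 5 3 (5 / 2) 1 6 3"
    "certificate 10 6 (19 / 5) (5 / 2) 1 4 3"
    "certificate 11 6 (19 / 5) (5 / 2) 1 5 3"
    "certificate 12 6 4 (5 / 2) 1 5 3"
    "certificate 13 6 4 (5 / 2) 1 6 3"
    "certificate 14 6 4 (5 / 2) 1 6 3"
    "certificate 11 7 5 (16 / 5) 1 4 4"
    "certificate 12 7 5 (16 / 5) 1 5 3"
    "certificate 13 7 5 (16 / 5) 1 6 3"
    "certificate 14 7 5 (16 / 5) 1 6 3"
    "certificate 13 8 (26 / 5) (16 / 5) 1 5 4"
    "certificate 14 8 (26 / 5) (16 / 5) 1 6 4"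
    "certificate 14 9 (299 / 50) (91 / 25) 1 5 4"
  by (simp_all add: certificate_def chord_slope_def admissible_def uniform_prob_eq_prod
      lessThan_nat_numeral fact_numeral power_divide)

theorem mainTheorem15:
  fixes b k :: nat
  assumes "(b, k) \<in> {(6,6),(7,6),(8,6),(9,6),(10,6),(11,6),(12,6),(13,6),(14,6),
                      (8,7),(9,7),(10,7),(11,7),(12,7),(13,7),(14,7),
                      (10,8),(11,8),(12,8),(13,8),(14,8),
                      (11,9),(12,9),(13,9),(14,9),(13,10),(14,10),(14,11)}"
  shows "R_hash b k < ereal (1 / (1 / log 2 (real b / (real k - 3))
            + real b ^ (k - 1) / ((\<Prod>i<k - 1. real (b - i)) * log 2 (real b - real k + 2))))"
proof -
  obtain m s t u w g where "certificate b m s t u w g" "k = m + 2"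
    using assms certificates by fastforce
  thus ?thesis by (rule R_hash_less_if_certificate)
qed

end
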